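(* Let $\mathcal G$ be an undirected graph on $N$ nodes with adjacency matrix $\mathbf A$ and node feature matrix $\mathbf X\in\mathbb R^{N\times F}$. There exist finite constants $C_1,C_2$ depending only on $\mathbf X$ and $\hat{\mathbf A}$ such that the following holds. Consider an $L$-layer GCN encoder with ReLU activation, $\mathbf X^{(0)}=\mathbf X$, $$\mathbf X^{(t+1)}=\operatorname{ReLU}\big(\hat{\mathbf A}\,\mathbf X^{(t)}\mathbf W^{(t)}\big),\qquad t=0,1,\dots,L-1,$$ and define $\phi^{(\ell)}(x_i;\mathbf X,\mathbf A):=(\mathbf X^{(\ell)})_{i\cdot}$. Assume $\|\mathbf W^{(t)}\|_2\le\beta$ for all $t$. Then for any nonempty $\mathcal S,\mathcal T\subseteq\{1,\dots,N\}$ and any $\ell\in\{0,1,\dots,L\}$, $$\mathcal W\big(\phi^{(\ell)}_\#\mu_{\mathcal S},\,\phi^{(\ell)}_\#\mu_{\mathcal T}\big)\;\le\;\Big(C_1\,\mathcal W\big(d_\#\mu_{\mathcal S},\,d_\#\mu_{\mathcal T}\big)+C_2\,\rho_\perp(\hat{\mathbf A})^{\ell}\Big)\beta^{\ell}.$$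
   Context: $\mathbf A\in\{0,1\}^{N\times N}$ is the symmetric adjacency matrix of the undirected graph; $\tilde{\mathbf A}=\mathbf A+\mathbf I$, $\tilde{\mathbf D}=\mathrm{diag}(\tilde{\mathbf A}\mathbf 1)$, $\hat{\mathbf A}=\tilde{\mathbf D}^{-1/2}\tilde{\mathbf A}\tilde{\mathbf D}^{-1/2}$. $\tilde d_i=(\tilde{\mathbf D})_{ii}$ is the degree of node $i$ after adding self-loops, and the degree statistic is $d(x_i)=\sqrt{\tilde d_i}\in\mathbb R$. $\lambda_1(\hat{\mathbf A})\ge\dots\ge\lambda_N(\hat{\mathbf A})$ are the eigenvalues of $\hat{\mathbf A}$ with multiplicity in descending order (the largest is $\lambda_1=1$), and $\rho_\perp(\hat{\mathbf A})=\max_{k\ge2}|\lambda_k(\hat{\mathbf A})|$. The weight matrices $\mathbf W^{(t)}$ are real matrices of compatible sizes (the number of rows of $\mathbf W^{(0)}$ is $F$); $\|\cdot\|_2$ is the spectral norm; $\operatorname{ReLU}(a)=\max\{a,0\}$ is applied entrywise. $M_{i\cdot}$ denotes the $i$-th row of a matrix $M$. For nonempty $\mathcal S\subseteq\{1,\dots,N\}$, $\mu_{\mathcal S}$ is the uniform probability measure on the nodes in $\mathcal S$, so $\phi^{(\ell)}_\#\mu_{\mathcal S}=\frac1{|\mathcal S|}\sum_{i\in\mathcal S}\delta_{\phi^{(\ell)}(x_i;\mathbf X,\mathbf A)}$ and $d_\#\mu_{\mathcal S}=\frac1{|\mathcal S|}\sum_{i\in\mathcal S}\delta_{d(x_i)}$.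 $\mathcal W$ is the $1$-Wasserstein distance with Euclidean cost. *)

theory Defs
  imports
    "HOL-Probability.Probability_Mass_Function"
    "Jordan_Normal_Form.Char_Poly"
begin

text \<open>Nodes, rows and columns are indexed from 0, so the node set is \<open>{0..<N}\<close>.\<close>

definition adjacency_matrix :: "nat \<Rightarrow> real mat \<Rightarrow> bool" where
  "adjacency_matrix N A \<longleftrightarrow>
     A \<in> carrier_mat N N \<and> (\<forall>i<N. \<forall>j<N. A $$ (i, j) \<in> {0, 1}) \<and> transpose_mat A = A"

definition add_loops :: "real mat \<Rightarrow> real mat" where
  "add_loops A = A + 1\<^sub>m (dim_row A)"

definition loop_degree :: "real mat \<Rightarrow> nat \<Rightarrow> real" where
  "loop_degree A i = (add_loops A *\<^sub>v Matrix.vec (dim_row A) (\<lambda>_. 1)) $ i"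

definition normalized_adjacency :: "real mat \<Rightarrow> real mat" where
  "normalized_adjacency A =
     (let D = mat_diag (dim_row A) (\<lambda>i. 1 / sqrt (loop_degree A i)) in D * add_loops A * D)"

definition degree_stat :: "real mat \<Rightarrow> nat \<Rightarrow> real" where
  "degree_stat A i = sqrt (loop_degree A i)"

text \<open>The real roots of the characteristic polynomial with multiplicity, in descending order;
  for a symmetric matrix these are all its eigenvalues.  \<open>eigval M k\<close> counts from
  \<open>k = 1\<close> (the largest eigenvalue).\<close>

definition eigvals_desc :: "real mat \<Rightarrow> real list" where
  "eigvals_desc M = rev (sorted_list_of_multiset (proots (char_poly M)))"

definition eigval :: "real mat \<Rightarrow> nat \<Rightarrow> real" where
  "eigval M k = eigvals_desc M ! (k - 1)"

text \<open>Inserting 0 only matters for \<open>1 \<times> 1\<close> and empty matrices, where the maximum would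
  range over the empty set.\<close>

definition rho_perp :: "real mat \<Rightarrow> real" where
  "rho_perp M = Max (insert 0 ((\<lambda>k. \<bar>eigval M k\<bar>) ` {2..dim_row M}))"

definition euclid_norm :: "real Matrix.vec \<Rightarrow> real" where
  "euclid_norm v = sqrt (v \<bullet> v)"

definition euclid_dist :: "real Matrix.vec \<Rightarrow> real Matrix.vec \<Rightarrow> real" where
  "euclid_dist u v = euclid_norm (u - v)"

definition spectral_norm :: "real mat \<Rightarrow> real" where
  "spectral_norm M =
     Sup {euclid_norm (M *\<^sub>v v) | v. v \<in> carrier_vec (dim_col M) \<and> euclid_norm v \<le> 1}"

definition relu :: "real \<Rightarrow> real" where
  "relu a = max a 0"

primrec gcn :: "real mat \<Rightarrow> real mat \<Rightarrow> (nat \<Rightarrow> real mat) \<Rightarrow> nat \<Rightarrow> real mat" where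
  "gcn Ahat X W 0 = X"
| "gcn Ahat X W (Suc t) = map_mat relu (Ahat * gcn Ahat X W t * W t)"

definition embedding :: "real mat \<Rightarrow> real mat \<Rightarrow> (nat \<Rightarrow> real mat) \<Rightarrow> nat \<Rightarrow> nat \<Rightarrow> real Matrix.vec" where
  "embedding A X W l i = Matrix.row (gcn (normalized_adjacency A) X W l) i"

text \<open>The 1-Wasserstein distance with cost \<open>c\<close>, for finitely supported marginals.  Every coupling
  of two such measures is again finitely supported, hence a \<open>pmf\<close>, and every expectation below is
  a finite sum.\<close>

definition couplings :: "'a pmf \<Rightarrow> 'a pmf \<Rightarrow> ('a \<times> 'a) pmf set" where
  "couplings p q = {r. map_pmf fst r = p \<and> map_pmf snd r = q}"

definition wasserstein :: "('a \<Rightarrow> 'a \<Rightarrow> real) \<Rightarrow> 'a pmf \<Rightarrow> 'a pmf \<Rightarrow> real" where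
  "wasserstein c p q = (INF r\<in>couplings p q. measure_pmf.expectation r (\<lambda>(x, y). c x y))"

end

theory Submission
  imports Defs "Jordan_Normal_Form.Schur_Decomposition"
begin

text \<open>The vector of the \<open>\<surd>d\<^sub>i\<close> is a nonnegative eigenvector of the normalized adjacency matrix for its
  largest eigenvalue 1; let \<open>u\<close> be its normalization, and split every layer as \<open>H = u w\<^sup>T + E\<close>
  with the columns of \<open>E\<close> orthogonal to \<open>u\<close>.  Multiplication by the adjacency matrix keeps the first
  part and contracts the second by \<open>\<rho>\<close>, a weight matrix costs at most a factor \<open>\<beta>\<close>, and \<open>ReLU\<close> does not
  increase the Frobenius distance to the matrices \<open>u w\<^sup>T\<close>.  So \<open>E\<close> is of size \<open>(\<rho> \<beta>)\<^sup>l\<close>, while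
  the rows of \<open>u w\<^sup>T\<close> depend on the node only through \<open>\<surd>d\<^sub>i\<close>, in a Lipschitz way with constant at most
  \<open>\<beta>\<^sup>l\<close> times the Frobenius norm of \<open>X\<close>.  A coupling of the degree statistics lifts to a coupling
  of the nodes, which turns this into the Wasserstein bound.\<close>

unbundle no inner_syntax and no vec_syntax

section \<open>Real symmetric matrices\<close>

text \<open>Not restricted to the reals: it is applied to a complex matrix below, with the
  unconjugated bilinear product.\<close>

lemma symmetric_scalar_prod:
  fixes M :: "'a :: comm_semiring_0 mat"
  assumes M: "M \<in> carrier_mat n n" and sym: "transpose_mat M = M"
    and x: "x \<in> carrier_vec n" and y: "y \<in> carrier_vec n"
  shows "(M *\<^sub>v x) \<bullet> y = x \<bullet> (M *\<^sub>v y)"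
  using transpose_vec_mult_scalar[OF M y x] sym by simp

text \<open>As \<open>M\<close> is real, conjugating an eigenvector for \<open>a\<close> gives one
  for \<open>cnj a\<close>. Moving the symmetric matrix across the product of \<open>v\<close> with
  its conjugate yields \<open>a * (v \<bullet>c v) = cnj a * (v \<bullet>c v)\<close>, and
  \<open>v \<bullet>c v\<close> is nonzero.\<close>

lemma real_symmetric_complex_eigenvalue_real:
  fixes M :: "real mat"
  assumes M: "M \<in> carrier_mat n n" and sym: "transpose_mat M = M"
    and ev: "eigenvalue (map_mat complex_of_real M) a"
  shows "a \<in> \<real>"
proof -
  let ?C = "map_mat complex_of_real M"
  have C: "?C \<in> carrier_mat n n" using M by auto
  have symC: "transpose_mat ?C = ?C" using sym M
    by (metis map_mat_transpose)
  from ev obtain v where v: "v \<in> carrier_vec n" "v \<noteq> 0\<^sub>v n" and eig: "?C *\<^sub>v v = a \<cdot>\<^sub>v v"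
    using C unfolding eigenvalue_def eigenvector_def by auto
  have cv: "conjugate v \<in> carrier_vec n" using v by simp
  have eigc: "?C *\<^sub>v conjugate v = cnj a \<cdot>\<^sub>v conjugate v"
  proof -
    have "?C *\<^sub>v conjugate v = conjugate (?C *\<^sub>v v)"
      using v M by (intro eq_vecI) (auto simp: scalar_prod_def mult_mat_vec_def row_def)
    also have "\<dots> = cnj a \<cdot>\<^sub>v conjugate v"
      unfolding eig by (simp add: conjugate_smult_vec)
    finally show ?thesis .
  qed
  have "a * (v \<bullet>c v) = (?C *\<^sub>v v) \<bullet>c v" unfolding eig using v cv by simp
  also have "\<dots> = v \<bullet> (?C *\<^sub>v conjugate v)"
    by (rule symmetric_scalar_prod[OF C symC v(1) cv])
  also have "\<dots> = cnj a * (v \<bullet>c v)" unfolding eigc using v cv by simp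
  finally have "a = cnj a" using v conjugate_square_eq_0_vec[OF v(1)] by simp
  then show ?thesis by (simp add: Reals_cnj_iff)
qed

text \<open>Over the complex numbers the polynomial splits, its roots are real, and the embedding of
  real polynomials is injective, so the factorization descends to the reals.\<close>

lemma real_symmetric_char_poly_splits:
  fixes M :: "real mat"
  assumes M: "M \<in> carrier_mat n n" and sym: "transpose_mat M = M"
  shows "\<exists>es. char_poly M = (\<Prod>e\<leftarrow>es. [:- e, 1:])"
proof -
  let ?C = "map_mat complex_of_real M"
  have C: "?C \<in> carrier_mat n n" using M by auto
  interpret mh: map_poly_inj_comm_ring_hom complex_of_real ..
  from char_poly_factorized[OF C] obtain as where
    as: "char_poly ?C = (\<Prod>a\<leftarrow>as. [:- a, 1:])" by blast
  have "a \<in> \<real>" if "a \<in> set as" for a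
  proof -
    have "poly (char_poly ?C) a = 0" unfolding as using that by (auto simp: poly_prod_list prod_list_zero_iff)
    then show ?thesis
      using real_symmetric_complex_eigenvalue_real[OF M sym] eigenvalue_root_char_poly[OF C] by blast
  qed
  then have re: "map (\<lambda>a. complex_of_real (Re a)) as = as"
    by (simp add: map_idI)
  have "map_poly complex_of_real (\<Prod>e\<leftarrow>map Re as. [:- e, 1:])
      = (\<Prod>a\<leftarrow>map (\<lambda>a. complex_of_real (Re a)) as. [:- a, 1:])"
    by (simp add: mh.hom_prod_list o_def)
  also have "\<dots> = map_poly complex_of_real (char_poly M)"
    unfolding re as[symmetric] of_real_hom.char_poly_hom[OF M] ..
  finally have "(\<Prod>e\<leftarrow>map Re as. [:- e, 1:]) = char_poly M" by simp
  then show ?thesis by metis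
qed

text \<open>Complete \<open>v\<close> to a basis, orthogonalize and normalize; Gram-Schmidt keeps
  the first vector, so column 0 gets the direction of \<open>v\<close>. With an eigenvector as
  \<open>v\<close> this is the change of basis for the deflation below.\<close>

lemma orthonormal_basis_completion:
  fixes v :: "real Matrix.vec"
  assumes v: "v \<in> carrier_vec n" and v0: "v \<noteq> 0\<^sub>v n"
  shows "\<exists>W \<in> carrier_mat n n. transpose_mat W * W = 1\<^sub>m n \<and> col W 0 = (1 / sqrt (v \<bullet> v)) \<cdot>\<^sub>v v"
proof -
  interpret cof_vec_space n "TYPE(real)" .
  define b where "b = basis_completion v"
  define ws where "ws = gram_schmidt n b"
  note bc = basis_completion[OF v v0, folded b_def]
  have n: "n \<noteq> 0" using v v0 by (metis carrier_vecD eq_vecI less_zeroE zero_carrier_vec)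
  from bc(6,7) n obtain vs where bv: "b = v # vs" by (cases b) auto
  have ws: "set ws \<subseteq> carrier_vec n" "corthogonal ws" "length ws = n"
    using gram_schmidt_result[OF bc(2) bc(4) bc(5) refl, folded ws_def] bc(6) by auto
  have "hd ws = v" unfolding ws_def bv by (rule gram_schmidt_hd[OF v])
  then have ws0: "ws ! 0 = v" using ws(3) n by (metis hd_conv_nth list.size(3))
  define nw where "nw w = (1 / sqrt (w \<bullet> w)) \<cdot>\<^sub>v w" for w :: "real Matrix.vec"
  define W where "W = mat_of_cols n (map nw ws)"
  have W: "W \<in> carrier_mat n n" unfolding W_def using ws(3) by (simp add: mat_of_cols_def)
  have wsc: "ws ! i \<in> carrier_vec n" if "i < n" for i using ws that by auto
  have colW: "col W i = nw (ws ! i)" if "i < n" for i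
    unfolding W_def using that ws(3) wsc[OF that] by (subst col_mat_of_cols) (auto simp: nw_def)
  have "transpose_mat W * W = 1\<^sub>m n"
  proof (rule eq_matI)
    fix i j assume "i < dim_row (1\<^sub>m n :: real mat)" "j < dim_col (1\<^sub>m n :: real mat)"
    then have i: "i < n" and j: "j < n" by auto
    have "(transpose_mat W * W) $$ (i, j) = nw (ws ! i) \<bullet> nw (ws ! j)"
      using i j W colW by simp
    also have "\<dots> = (ws ! i \<bullet> ws ! j) / (sqrt (ws ! i \<bullet> ws ! i) * sqrt (ws ! j \<bullet> ws ! j))"
      unfolding nw_def using wsc[OF i] wsc[OF j] by simp
    also have "\<dots> = (if i = j then 1 else 0)"
    proof (cases "i = j")
      case True
      have "ws ! i \<bullet> ws ! i \<noteq> 0" using corthogonalD[OF ws(2), of i i] i ws(3) by simp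
      moreover have "ws ! i \<bullet> ws ! i \<ge> 0" using conjugate_square_ge_0_vec[of "ws ! i"] by simp
      ultimately show ?thesis using True by simp
    next
      case False
      then show ?thesis using corthogonalD[OF ws(2), of i j] i j ws(3) by simp
    qed
    finally show "(transpose_mat W * W) $$ (i, j) = (1\<^sub>m n) $$ (i, j)" using i j by simp
  qed (use W in auto)
  moreover have "col W 0 = (1 / sqrt (v \<bullet> v)) \<cdot>\<^sub>v v" using colW[of 0] n ws0 by (simp add: nw_def)
  ultimately show ?thesis using W by blast
qed

text \<open>Spectral theorem by deflation: in an orthonormal basis that starts with an eigenvector
  for \<open>e\<close>, the matrix is block diagonal with blocks \<open>e\<close> and a smaller
  symmetric matrix, whose characteristic polynomial has the remaining factors. The order of
  \<open>es\<close> is arbitrary, so the diagonal can later be the sorted list of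
  eigenvalues.\<close>

lemma real_symmetric_diagonalization:
  fixes M :: "real mat"
  assumes "M \<in> carrier_mat n n" and "transpose_mat M = M"
    and "char_poly M = (\<Prod>e\<leftarrow>es. [:- e, 1:])"
  shows "\<exists>P \<in> carrier_mat n n. transpose_mat P * P = 1\<^sub>m n \<and> M * P = P * mat_diag n (\<lambda>i. es ! i)"
  using assms
proof (induction es arbitrary: n M)
  case Nil
  then have "n = 0" using degree_monic_char_poly[of M n] by simp
  then show ?case using Nil by (intro bexI[of _ "1\<^sub>m 0"]) (auto intro!: eq_matI simp: mat_diag_def)
next
  case (Cons e es n M)
  note M = Cons.prems(1) and sym = Cons.prems(2)
  have cp: "char_poly M = [:- e, 1:] * (\<Prod>e\<leftarrow>es. [:- e, 1:])" using Cons.prems(3) by simp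
  have "eigenvalue M e" unfolding eigenvalue_root_char_poly[OF M] cp by simp
  then obtain v where v: "v \<in> carrier_vec n" "v \<noteq> 0\<^sub>v n" "M *\<^sub>v v = e \<cdot>\<^sub>v v"
    using M unfolding eigenvalue_def eigenvector_def by auto
  from v have "n \<noteq> 0" by (metis carrier_vecD eq_vecI less_zeroE zero_carrier_vec)
  then obtain m where n: "n = Suc m" by (cases n) auto
  obtain W where W: "W \<in> carrier_mat n n" and WtW: "transpose_mat W * W = 1\<^sub>m n"
    and W0: "col W 0 = (1 / sqrt (v \<bullet> v)) \<cdot>\<^sub>v v"
    using orthonormal_basis_completion[OF v(1,2)] by blast
  have Wt: "transpose_mat W \<in> carrier_mat n n" using W by simp
  have WWt: "W * transpose_mat W = 1\<^sub>m n" using mat_mult_left_right_inverse[OF Wt W WtW] .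
  define B where "B = transpose_mat W * M * W"
  have B: "B \<in> carrier_mat n n" unfolding B_def using W M by auto
  have symB: "transpose_mat B = B"
    unfolding B_def using W M sym
    by (simp add: transpose_mult[of _ n n _ n] assoc_mult_mat[of _ n n _ n _ n])
  have MW: "M * W = W * B"
  proof -
    have "W * B = (W * transpose_mat W) * (M * W)"
      unfolding B_def using W M by (simp add: assoc_mult_mat[of _ n n _ n _ n])
    then show ?thesis using WWt W M by simp
  qed
  have MW0: "M *\<^sub>v col W 0 = e \<cdot>\<^sub>v col W 0"
    unfolding W0 using v M by (simp add: mult_mat_vec smult_smult_assoc mult.commute)
  \<comment> \<open>Column 0 holds the products of the orthonormal basis with \<open>e\<close> times
    its first vector.\<close>
  have B0: "B $$ (i, 0) = (if i = 0 then e else 0)" if i: "i < n" for i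
  proof -
    have "B $$ (i, 0) = col W i \<bullet> (M *\<^sub>v col W 0)"
      unfolding B_def using i n W M
      by (simp add: assoc_mult_mat[of _ n n _ n _ n] col_mult2[of _ n n _ n] mult_mat_vec_def)
    also have "\<dots> = e * (col W i \<bullet> col W 0)" unfolding MW0 using W i n by simp
    also have "col W i \<bullet> col W 0 = (transpose_mat W * W) $$ (i, 0)" using W i n by simp
    finally show ?thesis unfolding WtW using i n by simp
  qed
  define B3 where "B3 = mat m m (\<lambda>(i, j). B $$ (Suc i, Suc j))"
  define E where "E = mat 1 1 (\<lambda>_. e)"
  have B3: "B3 \<in> carrier_mat m m" and E: "E \<in> carrier_mat 1 1" unfolding B3_def E_def by auto
  have symBi: "B $$ (i, j) = B $$ (j, i)" if "i < n" "j < n" for i j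
    using that symB B by (metis carrier_matD index_transpose_mat(1))
  \<comment> \<open>Row 0 has the same zeros as column 0 by symmetry.\<close>
  have Bblock: "B = four_block_mat E (0\<^sub>m 1 m) (0\<^sub>m m 1) B3"
  proof (rule eq_matI)
    fix i j assume "i < dim_row (four_block_mat E (0\<^sub>m 1 m) (0\<^sub>m m 1) B3)"
      "j < dim_col (four_block_mat E (0\<^sub>m 1 m) (0\<^sub>m m 1) B3)"
    then have i: "i < n" and j: "j < n" using E B3 n by auto
    show "B $$ (i, j) = four_block_mat E (0\<^sub>m 1 m) (0\<^sub>m m 1) B3 $$ (i, j)"
      using i j n E B3 B0[OF i] B0[OF j] symBi[OF i j]
      by (cases i; cases j) (auto simp: E_def B3_def)
  qed (use B E B3 n in auto)
  have symB3: "transpose_mat B3 = B3"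
    unfolding B3_def using symBi n by (intro eq_matI) auto
  \<comment> \<open>Similar matrices share the characteristic polynomial; cancelling the factor of
    \<open>e\<close> leaves \<open>es\<close> for \<open>B3\<close>.\<close>
  have "similar_mat B M"
    using similar_mat_witI[OF WtW WWt _ B M Wt W] B_def unfolding similar_mat_def by blast
  then have "[:- e, 1:] * (\<Prod>e\<leftarrow>es. [:- e, 1:]) = char_poly B"
    using char_poly_similar cp by metis
  also have "\<dots> = char_poly E * char_poly B3"
    unfolding Bblock by (rule char_poly_four_block_zeros_col[OF E _ B3]) simp
  also have "char_poly E = [:- e, 1:]"
    by (simp add: E_def char_poly_defs det_def sign_def)
  finally have "char_poly B3 = (\<Prod>e\<leftarrow>es. [:- e, 1:])"
    by (metis mult_cancel_left pCons_eq_0_iff zero_neq_one)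
  from Cons.IH[OF B3 symB3 this] obtain Q where Q: "Q \<in> carrier_mat m m"
    and QtQ: "transpose_mat Q * Q = 1\<^sub>m m" and B3Q: "B3 * Q = Q * mat_diag m (\<lambda>i. es ! i)" by blast
  \<comment> \<open>\<open>Q\<close> diagonalizes the small block; padding it with a 1 leaves the
    eigenvector in place, and \<open>W * R\<close> is the required matrix.\<close>
  define R where "R = four_block_mat (1\<^sub>m 1) (0\<^sub>m 1 m) (0\<^sub>m m 1) Q"
  have R: "R \<in> carrier_mat n n" unfolding R_def n using Q by auto
  have RtR: "transpose_mat R * R = 1\<^sub>m n"
  proof -
    have "transpose_mat R = four_block_mat (1\<^sub>m 1) (0\<^sub>m 1 m) (0\<^sub>m m 1) (transpose_mat Q)"
      unfolding R_def using Q
      by (subst transpose_four_block_mat[of _ 1 1 _ m _ m]) auto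
    then have "transpose_mat R * R = four_block_mat (1\<^sub>m 1) (0\<^sub>m 1 m) (0\<^sub>m m 1) (1\<^sub>m m)"
      unfolding R_def using Q QtQ
      by (simp add: mult_four_block_mat[of _ 1 1 _ m _ m _ _ 1 _ m])
    then show ?thesis unfolding n by (auto intro!: eq_matI)
  qed
  have D: "mat_diag n (\<lambda>i. (e # es) ! i) = four_block_mat E (0\<^sub>m 1 m) (0\<^sub>m m 1) (mat_diag m (\<lambda>i. es ! i))"
    unfolding n E_def by (rule eq_matI) (auto simp: mat_diag_def nth_Cons')
  have BR: "B * R = R * mat_diag n (\<lambda>i. (e # es) ! i)"
    unfolding D Bblock R_def using Q E B3 B3Q
    by (simp add: mult_four_block_mat[of _ 1 1 _ m _ m _ _ 1 _ m]
        left_mult_zero_mat[OF mat_diag_dim] right_mult_zero_mat[OF mat_diag_dim])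
  have "M * (W * R) = (W * R) * mat_diag n (\<lambda>i. (e # es) ! i)"
  proof -
    have "M * (W * R) = W * (B * R)"
      using assoc_mult_mat[OF M W R] assoc_mult_mat[OF W B R] MW by simp
    also have "\<dots> = (W * R) * mat_diag n (\<lambda>i. (e # es) ! i)"
      unfolding BR using W R by (simp add: assoc_mult_mat[of _ n n _ n _ n])
    finally show ?thesis .
  qed
  moreover have "transpose_mat (W * R) * (W * R) = 1\<^sub>m n"
  proof -
    have "transpose_mat (W * R) * (W * R) = transpose_mat R * ((transpose_mat W * W) * R)"
      using W R by (simp add: transpose_mult[of _ n n _ n] assoc_mult_mat[of _ n n _ n _ n])
    then show ?thesis unfolding WtW using R RtR by simp
  qed
  ultimately show ?case using W R by (intro bexI[of _ "W * R"]) auto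
qed

lemma orthogonal_mat_scalar_prod:
  fixes P :: "real mat"
  assumes P: "P \<in> carrier_mat n n" and PtP: "transpose_mat P * P = 1\<^sub>m n"
    and c: "c \<in> carrier_vec n" and d: "d \<in> carrier_vec n"
  shows "(P *\<^sub>v c) \<bullet> (P *\<^sub>v d) = c \<bullet> d"
proof -
  have "(P *\<^sub>v c) \<bullet> (P *\<^sub>v d) = (transpose_mat P *\<^sub>v (P *\<^sub>v c)) \<bullet> d"
    using transpose_vec_mult_scalar[OF P d, of "P *\<^sub>v c"] P c by simp
  also have "transpose_mat P *\<^sub>v (P *\<^sub>v c) = c"
    using P c PtP by (simp add: assoc_mult_mat_vec[of _ n n _ n, symmetric])
  finally show ?thesis .
qed

section \<open>Sorted eigenvalues and contraction orthogonally to a top eigenvector\<close>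

text \<open>The characteristic polynomial splits over the reals, so its real roots with multiplicity
  account for all \<open>n\<close> eigenvalues.\<close>

lemma symmetric_eigvals_desc:
  assumes M: "M \<in> carrier_mat n n" and sym: "transpose_mat M = M"
  shows "char_poly M = (\<Prod>e\<leftarrow>eigvals_desc M. [:- e, 1:])" and "length (eigvals_desc M) = n"
    and "sorted (rev (eigvals_desc M))"
proof -
  obtain es where es: "char_poly M = (\<Prod>e\<leftarrow>es. [:- e, 1:])"
    using real_symmetric_char_poly_splits[OF M sym] by blast
  have "proots (\<Prod>e\<leftarrow>es. [:- e, 1:]) = mset es"
  proof (induction es)
    case (Cons e es)
    have "(\<Prod>e\<leftarrow>es. [:- e, 1:]) \<noteq> 0" by (auto simp: prod_list_zero_iff)
    then have "proots ([:- e, 1:] * (\<Prod>e\<leftarrow>es. [:- e, 1:])) = {#e#} + mset es"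
      using Cons.IH by (subst proots_mult) auto
    then show ?case by simp
  qed simp
  then have ms: "mset (eigvals_desc M) = mset es" unfolding eigvals_desc_def es by simp
  show "char_poly M = (\<Prod>e\<leftarrow>eigvals_desc M. [:- e, 1:])"
    unfolding es using ms by (metis mset_map prod_mset_prod_list)
  then have "degree (char_poly M) = length (eigvals_desc M)"
    by (metis degree_linear_factors)
  then show "length (eigvals_desc M) = n" using degree_monic_char_poly[OF M] by simp
  show "sorted (rev (eigvals_desc M))" unfolding eigvals_desc_def by simp
qed

lemma eigval_1_ge_eigenvalue:
  assumes M: "M \<in> carrier_mat n n" and sym: "transpose_mat M = M" and ev: "eigenvalue M a"
  shows "a \<le> eigval M 1"
proof -
  note es = symmetric_eigvals_desc[OF M sym]
  have "poly (char_poly M) a = 0" using ev eigenvalue_root_char_poly[OF M] by simp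
  then have "a \<in> set (eigvals_desc M)" unfolding es(1) by (auto simp: poly_prod_list prod_list_zero_iff)
  then obtain i where i: "i < n" "eigvals_desc M ! i = a" using es(2) by (metis in_set_conv_nth)
  have "sorted_wrt (\<ge>) (eigvals_desc M)" using es(3) by (simp add: sorted_wrt_rev)
  then have "eigvals_desc M ! i \<le> eigvals_desc M ! 0"
    using i es(2) by (cases "i = 0") (auto simp: sorted_wrt_iff_nth_less)
  then show ?thesis using i by (simp add: eigval_def)
qed

lemma eigenvalue_eigval:
  assumes M: "M \<in> carrier_mat n n" and sym: "transpose_mat M = M" and k: "1 \<le> k" "k \<le> n"
  shows "eigenvalue M (eigval M k)"
proof -
  note es = symmetric_eigvals_desc[OF M sym]
  have "eigval M k \<in> set (eigvals_desc M)" unfolding eigval_def using k es(2) by simp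
  then show ?thesis unfolding eigenvalue_root_char_poly[OF M] es(1) by (auto simp: poly_prod_list prod_list_zero_iff)
qed

lemma rho_perp_ge:
  assumes "2 \<le> k" "k \<le> dim_row M"
  shows "\<bar>eigval M k\<bar> \<le> rho_perp M"
  unfolding rho_perp_def using assms by (intro Max_ge) auto

lemma rho_perp_nonneg: "0 \<le> rho_perp M"
  unfolding rho_perp_def by (intro Max_ge) auto

text \<open>If the largest eigenvalue is repeated it also occurs among the \<open>\<lambda>\<^sub>k\<close> with \<open>k \<ge> 2\<close>, so the
  bound is trivial; otherwise \<open>u\<close> spans its eigenspace.\<close>

lemma rho_perp_contraction:
  assumes M: "M \<in> carrier_mat n n" and sym: "transpose_mat M = M"
    and u: "u \<in> carrier_vec n" "u \<noteq> 0\<^sub>v n" "M *\<^sub>v u = eigval M 1 \<cdot>\<^sub>v u"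
    and v: "v \<in> carrier_vec n" "u \<bullet> v = 0"
  shows "(M *\<^sub>v v) \<bullet> (M *\<^sub>v v) \<le> (rho_perp M)\<^sup>2 * (v \<bullet> v)"
proof -
  note es = symmetric_eigvals_desc[OF M sym]
  define e where "e i = eigvals_desc M ! i" for i
  obtain P where P: "P \<in> carrier_mat n n" and PtP: "transpose_mat P * P = 1\<^sub>m n"
    and MP: "M * P = P * mat_diag n e"
    using real_symmetric_diagonalization[OF M sym es(1)] unfolding e_def by blast
  have Pt: "transpose_mat P \<in> carrier_mat n n" using P by simp
  have PPt: "P * transpose_mat P = 1\<^sub>m n" using mat_mult_left_right_inverse[OF Pt P PtP] .
  have D: "mat_diag n e \<in> carrier_mat n n" by simp
  \<comment> \<open>\<open>c\<close> and \<open>a\<close> are the coordinates of \<open>v\<close>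
    and \<open>u\<close> in the eigenbasis given by \<open>P\<close>.\<close>
  define c where "c = transpose_mat P *\<^sub>v v"
  define a where "a = transpose_mat P *\<^sub>v u"
  have c: "c \<in> carrier_vec n" and a: "a \<in> carrier_vec n" unfolding c_def a_def using P u v by auto
  have Pc: "P *\<^sub>v c = v" and Pa: "P *\<^sub>v a = u" unfolding c_def a_def
    using P PPt u v by (simp_all add: assoc_mult_mat_vec[of _ n n _ n, symmetric])
  have MPx: "M *\<^sub>v (P *\<^sub>v x) = P *\<^sub>v (mat_diag n e *\<^sub>v x)" if "x \<in> carrier_vec n" for x
    using M P D MP that by (metis assoc_mult_mat_vec)
  have Dx: "mat_diag n e *\<^sub>v x = vec n (\<lambda>i. e i * x $ i)" if "x \<in> carrier_vec n" for x
    using that by (intro eq_vecI) (auto simp: mat_diag_def scalar_prod_def if_distrib if_distribR sum.delta cong: if_cong)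
  \<comment> \<open>The eigenvector equation in coordinates: \<open>a $ i\<close> can be nonzero
    only where \<open>e i\<close> is the top eigenvalue.\<close>
  have ea: "e i * a $ i = eigval M 1 * a $ i" if i: "i < n" for i
  proof -
    have Da: "mat_diag n e *\<^sub>v a \<in> carrier_vec n" using D a by (rule mult_mat_vec_carrier)
    have "mat_diag n e *\<^sub>v a = (transpose_mat P * P) *\<^sub>v (mat_diag n e *\<^sub>v a)"
      using Da unfolding PtP by simp
    also have "\<dots> = transpose_mat P *\<^sub>v (M *\<^sub>v u)"
      using assoc_mult_mat_vec[OF Pt P Da] MPx[OF a] Pa by simp
    also have "\<dots> = eigval M 1 \<cdot>\<^sub>v a" unfolding u(3) a_def using Pt u(1) by (simp add: mult_mat_vec)
    finally have "(mat_diag n e *\<^sub>v a) $ i = eigval M 1 * a $ i" using i a by simp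
    then show ?thesis using Dx[OF a] i by simp
  qed
  have ac: "(\<Sum>i<n. a $ i * c $ i) = 0"
    using orthogonal_mat_scalar_prod[OF P PtP a c] Pa Pc v(2) c
    by (simp add: scalar_prod_def atLeast0LessThan)
  have n: "n > 0" using u by (metis carrier_vecD eq_vecI gr0I less_zeroE zero_carrier_vec)
  \<comment> \<open>The list is indexed from 0 but \<open>eigval\<close> from 1, so the positions
    \<open>i > 0\<close> are those with \<open>k \<ge> 2\<close> in \<open>rho_perp\<close>.\<close>
  have erho: "\<bar>e i\<bar> \<le> rho_perp M" if "i < n" "i > 0" for i
    using rho_perp_ge[of "Suc i" M] that M by (simp add: eigval_def e_def)
  have ec: "\<bar>e i * c $ i\<bar> \<le> \<bar>rho_perp M * c $ i\<bar>" if i: "i < n" for i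
  proof (cases "i > 0 \<or> (\<exists>j<n. 0 < j \<and> e j = e 0)")
    case True
    then have "\<bar>e i\<bar> \<le> rho_perp M" using erho i by (metis gr0I)
    then show ?thesis by (auto simp: abs_mult intro!: mult_right_mono)
  next
    case False
    then have i0: "i = 0" by simp
    have e0: "eigval M 1 = e 0" by (simp add: eigval_def e_def)
    \<comment> \<open>Here the top eigenvalue is simple, so \<open>u\<close> has only coordinate 0,
      and orthogonality to \<open>u\<close> forces \<open>c $ 0 = 0\<close>.\<close>
    have a0: "a $ j = 0" if "j < n" "j \<noteq> 0" for j
      using ea[OF that(1)] False that e0 by auto
    have "a $ 0 \<noteq> 0"
    proof
      assume "a $ 0 = 0"
      then have "a $ j = 0" if "j < n" for j using a0 that by (cases "j = 0") auto
      then have "a = 0\<^sub>v n" using a by (intro eq_vecI) auto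
      moreover have "P *\<^sub>v 0\<^sub>v n = 0\<^sub>v n" using P by auto
      ultimately show False using Pa u by simp
    qed
    moreover have "a $ 0 * c $ 0 = 0"
      using ac a0 n by (subst (asm) sum.remove[of _ 0]) auto
    ultimately show ?thesis using i0 by simp
  qed
  have "(M *\<^sub>v v) \<bullet> (M *\<^sub>v v) = (mat_diag n e *\<^sub>v c) \<bullet> (mat_diag n e *\<^sub>v c)"
    using MPx[OF c] Pc orthogonal_mat_scalar_prod[OF P PtP mult_mat_vec_carrier[OF D c] mult_mat_vec_carrier[OF D c]]
    by simp
  also have "\<dots> = (\<Sum>i<n. (e i * c $ i)\<^sup>2)"
    unfolding Dx[OF c] by (simp add: scalar_prod_def atLeast0LessThan power2_eq_square)
  also have "\<dots> \<le> (\<Sum>i<n. (rho_perp M * c $ i)\<^sup>2)"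
    using ec by (intro sum_mono) (simp add: abs_le_square_iff)
  also have "\<dots> = (rho_perp M)\<^sup>2 * (c \<bullet> c)"
    using c by (simp add: scalar_prod_def atLeast0LessThan power2_eq_square sum_distrib_left mult_ac)
  also have "c \<bullet> c = v \<bullet> v"
    using orthogonal_mat_scalar_prod[OF P PtP c c] Pc by simp
  finally show ?thesis .
qed

section \<open>The normalized adjacency matrix\<close>

lemma add_loops_index:
  assumes "adjacency_matrix N A" "i < N" "j < N"
  shows "add_loops A $$ (i, j) = A $$ (i, j) + (if i = j then 1 else 0)"
  using assms by (auto simp: adjacency_matrix_def add_loops_def)

lemma add_loops_nonneg:
  assumes "adjacency_matrix N A" "i < N" "j < N"
  shows "0 \<le> add_loops A $$ (i, j)"
proof -
  have "A $$ (i, j) \<in> {0, 1}" using assms by (auto simp: adjacency_matrix_def)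
  then show ?thesis using add_loops_index[OF assms] by auto
qed

lemma add_loops_sym:
  assumes "adjacency_matrix N A" "i < N" "j < N"
  shows "add_loops A $$ (i, j) = add_loops A $$ (j, i)"
proof -
  have "A $$ (i, j) = A $$ (j, i)"
    using assms unfolding adjacency_matrix_def by (metis carrier_matD index_transpose_mat(1))
  then show ?thesis using add_loops_index assms by simp
qed

lemma loop_degree_sum:
  assumes "adjacency_matrix N A" "i < N"
  shows "loop_degree A i = (\<Sum>j<N. add_loops A $$ (i, j))"
  using assms by (auto simp: adjacency_matrix_def loop_degree_def add_loops_def scalar_prod_def
      atLeast0LessThan)

text \<open>The self-loop alone contributes 1. This makes the divisions by
  \<open>degree_stat\<close> safe, also at isolated nodes.\<close>

lemma loop_degree_ge_1:
  assumes A: "adjacency_matrix N A" and i: "i < N"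
  shows "1 \<le> loop_degree A i"
proof -
  have "A $$ (i, i) \<in> {0, 1}" using A i by (auto simp: adjacency_matrix_def)
  then have "1 \<le> add_loops A $$ (i, i)" using add_loops_index[OF A i i] by auto
  also have "\<dots> \<le> loop_degree A i"
    unfolding loop_degree_sum[OF A i] using add_loops_nonneg[OF A i] i
    by (intro member_le_sum) auto
  finally show ?thesis .
qed

lemma degree_stat_ge_1:
  "adjacency_matrix N A \<Longrightarrow> i < N \<Longrightarrow> 1 \<le> degree_stat A i"
  using loop_degree_ge_1 unfolding degree_stat_def by simp

lemma degree_stat_square:
  "adjacency_matrix N A \<Longrightarrow> i < N \<Longrightarrow> (degree_stat A i)\<^sup>2 = loop_degree A i"
  using loop_degree_ge_1[of N A i] unfolding degree_stat_def by simp

lemma normalized_adjacency_carrier: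
  assumes "adjacency_matrix N A"
  shows "normalized_adjacency A \<in> carrier_mat N N"
  using assms unfolding adjacency_matrix_def normalized_adjacency_def Let_def add_loops_def
  by (auto intro!: mult_carrier_mat[of _ N N])

lemma normalized_adjacency_index:
  assumes A: "adjacency_matrix N A" and i: "i < N" and j: "j < N"
  shows "normalized_adjacency A $$ (i, j) = add_loops A $$ (i, j) / (degree_stat A i * degree_stat A j)"
proof -
  have L: "add_loops A \<in> carrier_mat N N" and d: "dim_row A = N"
    using A by (auto simp: adjacency_matrix_def add_loops_def)
  show ?thesis
    unfolding normalized_adjacency_def Let_def d
    using L i j by (simp add: mat_diag_mult_left[of _ N N] mat_diag_mult_right[of _ N N] degree_stat_def)
qed

lemma normalized_adjacency_sym:
  assumes A: "adjacency_matrix N A"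
  shows "transpose_mat (normalized_adjacency A) = normalized_adjacency A"
  using normalized_adjacency_carrier[OF A]
  by (intro eq_matI) (auto simp: normalized_adjacency_index[OF A] add_loops_sym[OF A] mult.commute)

lemma normalized_adjacency_mult_vec:
  assumes A: "adjacency_matrix N A" and i: "i < N" and v: "v \<in> carrier_vec N"
  shows "(normalized_adjacency A *\<^sub>v v) $ i
    = (\<Sum>j<N. add_loops A $$ (i, j) * (v $ j / degree_stat A j)) / degree_stat A i"
  using normalized_adjacency_carrier[OF A] i v
  by (auto simp: scalar_prod_def atLeast0LessThan normalized_adjacency_index[OF A]
      sum_divide_distrib mult_ac intro!: sum.cong)

text \<open>The row sums of \<open>add_loops A\<close> are the squares of
  \<open>degree_stat\<close>, and one factor cancels against the normalization.\<close>

lemma normalized_adjacency_degree_stat: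
  assumes A: "adjacency_matrix N A"
  shows "normalized_adjacency A *\<^sub>v vec N (degree_stat A) = vec N (degree_stat A)"
proof (rule eq_vecI)
  fix i assume "i < dim_vec (vec N (degree_stat A))"
  then have i: "i < N" by simp
  have "(\<Sum>j<N. add_loops A $$ (i, j) * (vec N (degree_stat A) $ j / degree_stat A j)) = loop_degree A i"
    unfolding loop_degree_sum[OF A i] using degree_stat_ge_1[OF A] by (intro sum.cong) (auto, fastforce)
  then show "(normalized_adjacency A *\<^sub>v vec N (degree_stat A)) $ i = vec N (degree_stat A) $ i"
    using i degree_stat_ge_1[OF A i]
    by (simp add: normalized_adjacency_mult_vec[OF A] degree_stat_square[OF A i, symmetric] power2_eq_square)
qed (use normalized_adjacency_carrier[OF A] in auto)

text \<open>Cauchy--Schwarz with the weights of row \<open>i\<close>, whose total is \<open>loop_degree A i\<close>.\<close>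

lemma normalized_adjacency_norm_le:
  assumes A: "adjacency_matrix N A" and v: "v \<in> carrier_vec N"
  shows "(normalized_adjacency A *\<^sub>v v) \<bullet> (normalized_adjacency A *\<^sub>v v) \<le> v \<bullet> v"
proof -
  let ?a = "\<lambda>i j. add_loops A $$ (i, j)" and ?d = "degree_stat A"
  have row: "((normalized_adjacency A *\<^sub>v v) $ i)\<^sup>2 \<le> (\<Sum>j<N. ?a i j * (v $ j / ?d j)\<^sup>2)" if i: "i < N" for i
  proof -
    \<comment> \<open>Each weight is split into two square roots, one for each factor of
      Cauchy-Schwarz.\<close>
    have "(\<Sum>j<N. ?a i j * (v $ j / ?d j))\<^sup>2 = (\<Sum>j<N. sqrt (?a i j) * (sqrt (?a i j) * (v $ j / ?d j)))\<^sup>2"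
      using add_loops_nonneg[OF A i] by (intro arg_cong[where f = "\<lambda>x. x\<^sup>2"] sum.cong) auto
    also have "\<dots> \<le> (\<Sum>j<N. (sqrt (?a i j))\<^sup>2) * (\<Sum>j<N. (sqrt (?a i j) * (v $ j / ?d j))\<^sup>2)"
      by (rule Cauchy_Schwarz_ineq_sum)
    also have "\<dots> = (?d i)\<^sup>2 * (\<Sum>j<N. ?a i j * (v $ j / ?d j)\<^sup>2)"
      unfolding degree_stat_square[OF A i] loop_degree_sum[OF A i]
      using add_loops_nonneg[OF A i] by (intro arg_cong2[where f = "(*)"] sum.cong) (auto simp: power_mult_distrib power_divide)
    finally show ?thesis
      using degree_stat_ge_1[OF A i]
      by (simp add: normalized_adjacency_mult_vec[OF A i v] power_divide divide_le_eq mult.commute)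
  qed
  have "(normalized_adjacency A *\<^sub>v v) \<bullet> (normalized_adjacency A *\<^sub>v v)
      = (\<Sum>i<N. ((normalized_adjacency A *\<^sub>v v) $ i)\<^sup>2)"
    using normalized_adjacency_carrier[OF A] by (simp add: scalar_prod_def[of "_ *\<^sub>v _"] atLeast0LessThan power2_eq_square)
  also have "\<dots> \<le> (\<Sum>i<N. \<Sum>j<N. ?a i j * (v $ j / ?d j)\<^sup>2)"
    using row by (intro sum_mono) simp
  \<comment> \<open>After the exchange of sums, symmetry makes the inner sum of weights a loop
    degree, which cancels the squared denominator.\<close>
  also have "\<dots> = (\<Sum>j<N. \<Sum>i<N. ?a j i * (v $ j / ?d j)\<^sup>2)"
    by (subst sum.swap) (intro sum.cong refl, simp add: add_loops_sym[OF A])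
  also have "\<dots> = (\<Sum>j<N. (v $ j)\<^sup>2)"
  proof (intro sum.cong refl)
    fix j assume "j \<in> {..<N}"
    then have j: "j < N" by simp
    show "(\<Sum>i<N. ?a j i * (v $ j / ?d j)\<^sup>2) = (v $ j)\<^sup>2"
      unfolding sum_distrib_right[symmetric] loop_degree_sum[OF A j, symmetric] degree_stat_square[OF A j, symmetric]
      using degree_stat_ge_1[OF A j] by (simp add: power_divide)
  qed
  also have "\<dots> = v \<bullet> v" using v by (simp add: scalar_prod_def atLeast0LessThan power2_eq_square)
  finally show ?thesis .
qed

lemma normalized_adjacency_eigenvalue_le:
  assumes A: "adjacency_matrix N A" and ev: "eigenvalue (normalized_adjacency A) a"
  shows "\<bar>a\<bar> \<le> 1"
proof -
  note C = normalized_adjacency_carrier[OF A]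
  from ev C obtain v where v: "v \<in> carrier_vec N" "v \<noteq> 0\<^sub>v N" "normalized_adjacency A *\<^sub>v v = a \<cdot>\<^sub>v v"
    unfolding eigenvalue_def eigenvector_def by auto
  have pos: "v \<bullet> v > 0" using conjugate_square_greater_0_vec[OF v(1)] v(2) by simp
  have "a\<^sup>2 * (v \<bullet> v) \<le> 1 * (v \<bullet> v)"
    using normalized_adjacency_norm_le[OF A v(1)] v by (simp add: power2_eq_square)
  then have "a\<^sup>2 \<le> 1" using pos by (simp only: mult_le_cancel_right_pos)
  then show ?thesis by (simp add: abs_square_le_1)
qed

text \<open>Nonexpansiveness rules out eigenvalues above 1, and the vector of the
  \<open>degree_stat\<close> attains 1. Its normalization therefore meets the eigenvector hypothesis
  of \<open>rho_perp_contraction\<close>.\<close>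

lemma normalized_adjacency_eigval_1:
  assumes A: "adjacency_matrix N A" and N: "N > 0"
  shows "eigval (normalized_adjacency A) 1 = 1"
proof (rule antisym)
  note C = normalized_adjacency_carrier[OF A] and S = normalized_adjacency_sym[OF A]
  show "eigval (normalized_adjacency A) 1 \<le> 1"
    using normalized_adjacency_eigenvalue_le[OF A eigenvalue_eigval[OF C S, of 1]] N by simp
  have "vec N (degree_stat A) \<noteq> 0\<^sub>v N"
    using degree_stat_ge_1[OF A N] N by (metis index_vec index_zero_vec(1) not_one_le_zero)
  then have "eigenvalue (normalized_adjacency A) 1"
    using normalized_adjacency_degree_stat[OF A] C unfolding eigenvalue_def eigenvector_def
    by (intro exI[of _ "vec N (degree_stat A)"]) auto
  then show "1 \<le> eigval (normalized_adjacency A) 1" by (rule eigval_1_ge_eigenvalue[OF C S])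
qed

section \<open>Frobenius and spectral norm\<close>

lemma euclid_norm_L2_set: "euclid_norm v = L2_set (\<lambda>i. v $ i) {..<dim_vec v}"
  by (simp add: euclid_norm_def L2_set_def scalar_prod_def atLeast0LessThan power2_eq_square)

lemma euclid_norm_nonneg: "0 \<le> euclid_norm v"
  by (simp add: euclid_norm_L2_set)

lemma euclid_norm_square: "(euclid_norm v)\<^sup>2 = v \<bullet> v"
  using conjugate_square_ge_0_vec[of v] by (simp add: euclid_norm_def)

lemma euclid_norm_sum: "(euclid_norm v)\<^sup>2 = (\<Sum>i<dim_vec v. (v $ i)\<^sup>2)"
  unfolding euclid_norm_square by (simp add: scalar_prod_def atLeast0LessThan power2_eq_square)

lemma euclid_norm_triangle:
  assumes "x \<in> carrier_vec n" "y \<in> carrier_vec n"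
  shows "euclid_norm (x + y) \<le> euclid_norm x + euclid_norm y"
proof -
  have "euclid_norm (x + y) = L2_set (\<lambda>i. x $ i + y $ i) {..<n}"
    unfolding euclid_norm_L2_set using assms by (auto intro: L2_set_cong)
  also have "\<dots> \<le> euclid_norm x + euclid_norm y"
    unfolding euclid_norm_L2_set using assms L2_set_triangle_ineq by fastforce
  finally show ?thesis .
qed

lemma euclid_norm_smult: "euclid_norm (a \<cdot>\<^sub>v x) = \<bar>a\<bar> * euclid_norm x"
proof -
  have "(a \<cdot>\<^sub>v x) \<bullet> (a \<cdot>\<^sub>v x) = a\<^sup>2 * (x \<bullet> x)"
    by (simp add: scalar_prod_def sum_distrib_left power2_eq_square mult_ac)
  then show ?thesis by (simp add: euclid_norm_def real_sqrt_mult)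
qed

lemma euclid_norm_Cauchy_Schwarz:
  assumes "x \<in> carrier_vec n" "y \<in> carrier_vec n"
  shows "\<bar>x \<bullet> y\<bar> \<le> euclid_norm x * euclid_norm y"
proof -
  have "\<bar>x \<bullet> y\<bar> \<le> (\<Sum>i<n. \<bar>x $ i\<bar> * \<bar>y $ i\<bar>)"
    using assms sum_abs[of "\<lambda>i. x $ i * y $ i" "{..<n}"] by (simp add: scalar_prod_def atLeast0LessThan abs_mult)
  also have "\<dots> \<le> euclid_norm x * euclid_norm y"
    unfolding euclid_norm_L2_set using assms by (auto intro: L2_set_mult_ineq)
  finally show ?thesis .
qed

text \<open>Kept squared so that it is a sum over rows as well as over columns: right multiplication
  is estimated row by row, left multiplication column by column.\<close>

definition frobenius_sq :: "real mat \<Rightarrow> real" where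
  "frobenius_sq M = (\<Sum>i<dim_row M. \<Sum>j<dim_col M. (M $$ (i, j))\<^sup>2)"

lemma frobenius_sq_nonneg: "0 \<le> frobenius_sq M"
  unfolding frobenius_sq_def by (intro sum_nonneg) simp

lemma frobenius_sq_rows: "frobenius_sq M = (\<Sum>i<dim_row M. (euclid_norm (row M i))\<^sup>2)"
  by (simp add: frobenius_sq_def euclid_norm_sum)

lemma frobenius_sq_cols: "frobenius_sq M = (\<Sum>j<dim_col M. (euclid_norm (col M j))\<^sup>2)"
  by (simp add: frobenius_sq_def euclid_norm_sum) (subst sum.swap, simp)

lemma euclid_norm_row_le_frobenius:
  assumes "i < dim_row M"
  shows "euclid_norm (row M i) \<le> sqrt (frobenius_sq M)"
  unfolding frobenius_sq_rows using assms
  by (intro real_le_rsqrt member_le_sum[where f = "\<lambda>i. (euclid_norm (row M i))\<^sup>2"]) auto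

text \<open>Cauchy-Schwarz in each row. It provides the upper bound that makes the supremum in
  \<open>spectral_norm\<close> meaningful.\<close>

lemma euclid_norm_mult_mat_vec_le:
  assumes W: "W \<in> carrier_mat m n" and v: "v \<in> carrier_vec n"
  shows "euclid_norm (W *\<^sub>v v) \<le> sqrt (frobenius_sq W) * euclid_norm v"
proof -
  have "(euclid_norm (W *\<^sub>v v))\<^sup>2 = (\<Sum>i<m. (row W i \<bullet> v)\<^sup>2)"
    using W by (simp add: euclid_norm_sum)
  also have "\<dots> \<le> (\<Sum>i<m. (euclid_norm (row W i))\<^sup>2 * (euclid_norm v)\<^sup>2)"
  proof (intro sum_mono)
    fix i
    have "\<bar>row W i \<bullet> v\<bar> \<le> \<bar>euclid_norm (row W i) * euclid_norm v\<bar>"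
      using euclid_norm_Cauchy_Schwarz[of "row W i" n v] W v euclid_norm_nonneg by fastforce
    then show "(row W i \<bullet> v)\<^sup>2 \<le> (euclid_norm (row W i))\<^sup>2 * (euclid_norm v)\<^sup>2"
      by (simp add: abs_le_square_iff power_mult_distrib)
  qed
  also have "\<dots> = frobenius_sq W * (euclid_norm v)\<^sup>2"
    using W by (simp add: frobenius_sq_rows sum_distrib_right)
  also have "\<dots> = (sqrt (frobenius_sq W) * euclid_norm v)\<^sup>2"
    using frobenius_sq_nonneg by (simp add: power_mult_distrib)
  finally show ?thesis
    using power2_le_imp_le frobenius_sq_nonneg euclid_norm_nonneg by (metis mult_nonneg_nonneg real_sqrt_ge_zero)
qed

lemma spectral_norm_ub:
  assumes W: "W \<in> carrier_mat m n" and v: "v \<in> carrier_vec n" "euclid_norm v \<le> 1"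
  shows "euclid_norm (W *\<^sub>v v) \<le> spectral_norm W"
  unfolding spectral_norm_def
proof (rule cSup_upper)
  show "bdd_above {euclid_norm (W *\<^sub>v v) |v. v \<in> carrier_vec (dim_col W) \<and> euclid_norm v \<le> 1}"
  proof (rule bdd_aboveI)
    fix x assume "x \<in> {euclid_norm (W *\<^sub>v v) |v. v \<in> carrier_vec (dim_col W) \<and> euclid_norm v \<le> 1}"
    then obtain v where v: "v \<in> carrier_vec n" "euclid_norm v \<le> 1" and x: "x = euclid_norm (W *\<^sub>v v)"
      using W by auto
    have "x \<le> sqrt (frobenius_sq W) * euclid_norm v" unfolding x by (rule euclid_norm_mult_mat_vec_le[OF W v(1)])
    also have "\<dots> \<le> sqrt (frobenius_sq W) * 1"
      using v(2) frobenius_sq_nonneg by (intro mult_left_mono) auto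
    finally show "x \<le> sqrt (frobenius_sq W)" by simp
  qed
qed (use W v in auto)

lemma spectral_norm_nonneg: "0 \<le> spectral_norm W"
proof -
  have "euclid_norm (0\<^sub>v (dim_col W)) \<le> 1" by (simp add: euclid_norm_def)
  then have "euclid_norm (W *\<^sub>v 0\<^sub>v (dim_col W)) \<le> spectral_norm W"
    by (intro spectral_norm_ub[of W "dim_row W" "dim_col W"]) auto
  then show ?thesis using euclid_norm_nonneg order_trans by blast
qed

lemma euclid_norm_eq_0:
  assumes "v \<in> carrier_vec n" "euclid_norm v = 0"
  shows "v = 0\<^sub>v n"
  using assms conjugate_square_eq_0_vec[OF assms(1)] by (simp add: euclid_norm_def)

lemma spectral_norm_bound:
  assumes W: "W \<in> carrier_mat m n" and v: "v \<in> carrier_vec n"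
  shows "euclid_norm (W *\<^sub>v v) \<le> spectral_norm W * euclid_norm v"
proof (cases "euclid_norm v = 0")
  case True
  then have "v = 0\<^sub>v n" using euclid_norm_eq_0[OF v] by simp
  then have "W *\<^sub>v v = 0\<^sub>v m" using W by auto
  then show ?thesis using True by (simp add: euclid_norm_def)
next
  case False
  then have pos: "euclid_norm v > 0" using euclid_norm_nonneg[of v] by simp
  have "euclid_norm (W *\<^sub>v ((1 / euclid_norm v) \<cdot>\<^sub>v v)) \<le> spectral_norm W"
    using pos v by (intro spectral_norm_ub[OF W]) (auto simp: euclid_norm_smult)
  moreover have "W *\<^sub>v ((1 / euclid_norm v) \<cdot>\<^sub>v v) = (1 / euclid_norm v) \<cdot>\<^sub>v (W *\<^sub>v v)"
    using W v by (rule mult_mat_vec)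
  ultimately show ?thesis using pos by (simp add: euclid_norm_smult divide_le_eq)
qed

text \<open>\<open>\<parallel>W\<^sup>T x\<parallel>\<^sup>2 = \<langle>x, W W\<^sup>T x\<rangle> \<le> \<parallel>x\<parallel> \<parallel>W\<parallel> \<parallel>W\<^sup>T x\<parallel>\<close>\<close>

lemma spectral_norm_transpose_bound:
  assumes W: "W \<in> carrier_mat m n" and x: "x \<in> carrier_vec m"
  shows "euclid_norm (transpose_mat W *\<^sub>v x) \<le> spectral_norm W * euclid_norm x"
proof -
  let ?y = "transpose_mat W *\<^sub>v x"
  have y: "?y \<in> carrier_vec n" using W x by (intro mult_mat_vec_carrier[of _ n m]) auto
  have "(euclid_norm ?y)\<^sup>2 = x \<bullet> (W *\<^sub>v ?y)"
    unfolding euclid_norm_square by (rule transpose_vec_mult_scalar[OF W y x])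
  also have "\<dots> \<le> euclid_norm x * euclid_norm (W *\<^sub>v ?y)"
    using euclid_norm_Cauchy_Schwarz[OF x mult_mat_vec_carrier[OF W y]] by simp
  also have "\<dots> \<le> euclid_norm x * (spectral_norm W * euclid_norm ?y)"
    by (intro mult_left_mono spectral_norm_bound[OF W y] euclid_norm_nonneg)
  finally have "euclid_norm ?y * euclid_norm ?y \<le> (spectral_norm W * euclid_norm x) * euclid_norm ?y"
    by (simp add: power2_eq_square mult_ac)
  then show ?thesis
    using euclid_norm_nonneg[of ?y] euclid_norm_nonneg[of x] spectral_norm_nonneg[of W]
    by (cases "euclid_norm ?y = 0") auto
qed

text \<open>The rows of \<open>E * W\<close> are \<open>transpose_mat W\<close> applied to the rows
  of \<open>E\<close>, which is why the transpose had to be bounded.\<close>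

lemma frobenius_sq_mult_right_le:
  assumes E: "E \<in> carrier_mat k m" and W: "W \<in> carrier_mat m n" and b: "spectral_norm W \<le> b"
  shows "frobenius_sq (E * W) \<le> b\<^sup>2 * frobenius_sq E"
proof -
  have row_le: "euclid_norm (row (E * W) i) \<le> b * euclid_norm (row E i)" if i: "i < k" for i
  proof -
    have "row (E * W) i = transpose_mat W *\<^sub>v row E i"
      using E W i by (intro eq_vecI) (auto simp: comm_scalar_prod[of _ m])
    moreover have "row E i \<in> carrier_vec m" using E by (metis carrier_matD(2) row_carrier)
    ultimately have "euclid_norm (row (E * W) i) \<le> spectral_norm W * euclid_norm (row E i)"
      using spectral_norm_transpose_bound[OF W] by simp
    also have "\<dots> \<le> b * euclid_norm (row E i)"
      by (intro mult_right_mono b euclid_norm_nonneg)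
    finally show ?thesis .
  qed
  have "(euclid_norm (row (E * W) i))\<^sup>2 \<le> b\<^sup>2 * (euclid_norm (row E i))\<^sup>2" if "i < k" for i
    using power_mono[OF row_le[OF that] euclid_norm_nonneg, of 2] by (simp add: power_mult_distrib)
  then show ?thesis
    unfolding frobenius_sq_rows sum_distrib_left using E by (auto intro!: sum_mono)
qed

text \<open>The bound is asked of the columns of \<open>E\<close> only, so it may be a contraction
  that holds just orthogonally to \<open>u\<close>.\<close>

lemma frobenius_sq_mult_left_le:
  assumes A: "A \<in> carrier_mat m n" and E: "E \<in> carrier_mat n k"
    and b: "\<And>j. j < k \<Longrightarrow> (A *\<^sub>v col E j) \<bullet> (A *\<^sub>v col E j) \<le> c * (col E j \<bullet> col E j)"
  shows "frobenius_sq (A * E) \<le> c * frobenius_sq E"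
proof -
  have "frobenius_sq (A * E) = (\<Sum>j<k. (A *\<^sub>v col E j) \<bullet> (A *\<^sub>v col E j))"
    unfolding frobenius_sq_cols euclid_norm_square using E by (intro sum.cong) (auto simp: col_mult2[OF A E])
  also have "\<dots> \<le> (\<Sum>j<k. c * (col E j \<bullet> col E j))" using b by (intro sum_mono) simp
  also have "\<dots> = c * frobenius_sq E"
    unfolding frobenius_sq_cols euclid_norm_square using E by (simp add: sum_distrib_left)
  finally show ?thesis .
qed

section \<open>Layers of the network\<close>

lemma frobenius_sq_mono_abs:
  assumes "Y \<in> carrier_mat m n" "Z \<in> carrier_mat m n"
    and "\<And>i j. i < m \<Longrightarrow> j < n \<Longrightarrow> \<bar>Y $$ (i, j)\<bar> \<le> \<bar>Z $$ (i, j)\<bar>"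
  shows "frobenius_sq Y \<le> frobenius_sq Z"
  unfolding frobenius_sq_def using assms by (auto intro!: sum_mono simp: abs_le_square_iff)

section \<open>Outer products with a fixed unit vector and the distance to them\<close>

definition rank1_mat :: "real vec \<Rightarrow> real vec \<Rightarrow> real mat" where
  "rank1_mat u w = mat (dim_vec u) (dim_vec w) (\<lambda>(i, j). u $ i * w $ j)"

lemma rank1_mat_carrier:
  "u \<in> carrier_vec m \<Longrightarrow> w \<in> carrier_vec n \<Longrightarrow> rank1_mat u w \<in> carrier_mat m n"
  by (auto simp: rank1_mat_def)

lemma rank1_mat_index:
  "u \<in> carrier_vec m \<Longrightarrow> w \<in> carrier_vec n \<Longrightarrow> i < m \<Longrightarrow> j < n \<Longrightarrow> rank1_mat u w $$ (i, j) = u $ i * w $ j"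
  by (auto simp: rank1_mat_def)

lemma col_minus_rank1_mat:
  assumes "H \<in> carrier_mat m n" "u \<in> carrier_vec m" "w \<in> carrier_vec n" "j < n"
  shows "col (H - rank1_mat u w) j = col H j - w $ j \<cdot>\<^sub>v u"
  using assms by (intro eq_vecI) (auto simp: rank1_mat_def mult.commute)

text \<open>In each column this completes the square in \<open>w $ j\<close>, as \<open>u\<close> is
  a unit vector. Only the last sum depends on \<open>w\<close>.\<close>

lemma frobenius_sq_minus_rank1:
  assumes H: "H \<in> carrier_mat m n" and u: "u \<in> carrier_vec m" "u \<bullet> u = 1" and w: "w \<in> carrier_vec n"
  shows "frobenius_sq (H - rank1_mat u w)
    = frobenius_sq H - (\<Sum>j<n. (u \<bullet> col H j)\<^sup>2) + (\<Sum>j<n. (u \<bullet> col H j - w $ j)\<^sup>2)"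
proof -
  have "(euclid_norm (col (H - rank1_mat u w) j))\<^sup>2
      = (euclid_norm (col H j))\<^sup>2 - (u \<bullet> col H j)\<^sup>2 + (u \<bullet> col H j - w $ j)\<^sup>2" if j: "j < n" for j
  proof -
    have h: "col H j \<in> carrier_vec m" using H by auto
    have "(euclid_norm (col (H - rank1_mat u w) j))\<^sup>2 = (\<Sum>i<m. (col H j $ i - w $ j * u $ i)\<^sup>2)"
      unfolding col_minus_rank1_mat[OF H u(1) w j] euclid_norm_sum using u(1) H j by (intro sum.cong) auto
    also have "\<dots> = (\<Sum>i<m. (col H j $ i)\<^sup>2) - 2 * w $ j * (\<Sum>i<m. u $ i * col H j $ i)
        + (w $ j)\<^sup>2 * (\<Sum>i<m. u $ i * u $ i)"
      by (simp add: sum_distrib_left sum_subtractf[symmetric] sum.distrib[symmetric] power2_eq_square algebra_simps)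
    also have "(\<Sum>i<m. (col H j $ i)\<^sup>2) = (euclid_norm (col H j))\<^sup>2" using H by (simp add: euclid_norm_sum)
    also have "(\<Sum>i<m. u $ i * col H j $ i) = u \<bullet> col H j" using h H by (simp add: scalar_prod_def atLeast0LessThan)
    also have "(\<Sum>i<m. u $ i * u $ i) = 1" using u by (simp add: scalar_prod_def atLeast0LessThan)
    finally show ?thesis by (simp add: power2_eq_square algebra_simps)
  qed
  moreover have dim: "dim_col (H - rank1_mat u w) = n" using rank1_mat_carrier[OF u(1) w] by auto
  ultimately show ?thesis
    unfolding frobenius_sq_cols dim using H by (simp add: sum.distrib sum_subtractf)
qed

text \<open>\<open>u (H\<^sup>T u)\<^sup>T\<close> is the orthogonal projection of the columns of \<open>H\<close> to the line spanned by the
  unit vector \<open>u\<close>.\<close>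

definition col_coords :: "real vec \<Rightarrow> real mat \<Rightarrow> real vec" where
  "col_coords u H = vec (dim_col H) (\<lambda>j. u \<bullet> col H j)"

definition residual :: "real vec \<Rightarrow> real mat \<Rightarrow> real mat" where
  "residual u H = H - rank1_mat u (col_coords u H)"

lemma col_coords_carrier: "H \<in> carrier_mat m n \<Longrightarrow> col_coords u H \<in> carrier_vec n"
  by (auto simp: col_coords_def)

lemma residual_carrier:
  "H \<in> carrier_mat m n \<Longrightarrow> u \<in> carrier_vec m \<Longrightarrow> residual u H \<in> carrier_mat m n"
  unfolding residual_def using rank1_mat_carrier col_coords_carrier by (metis minus_carrier_mat)

text \<open>Pythagoras: at the projection the last sum above vanishes. The identity bounds both the
  coordinates and the residual by the norm of \<open>H\<close>.\<close>

lemma frobenius_sq_residual: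
  assumes H: "H \<in> carrier_mat m n" and u: "u \<in> carrier_vec m" "u \<bullet> u = 1"
  shows "frobenius_sq (residual u H) = frobenius_sq H - (euclid_norm (col_coords u H))\<^sup>2"
  unfolding residual_def frobenius_sq_minus_rank1[OF H u col_coords_carrier[OF H]] euclid_norm_sum
  using H by (simp add: col_coords_def)

text \<open>Best approximation by the projection; it allows comparison with any convenient
  \<open>w\<close>, such as a vector that has passed through ReLU.\<close>

lemma frobenius_sq_residual_le:
  assumes H: "H \<in> carrier_mat m n" and u: "u \<in> carrier_vec m" "u \<bullet> u = 1" and w: "w \<in> carrier_vec n"
  shows "frobenius_sq (residual u H) \<le> frobenius_sq (H - rank1_mat u w)"
  unfolding frobenius_sq_residual[OF H u] frobenius_sq_minus_rank1[OF H u w] euclid_norm_sum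
  using H by (simp add: col_coords_def sum_nonneg)

lemma residual_orthogonal:
  assumes H: "H \<in> carrier_mat m n" and u: "u \<in> carrier_vec m" "u \<bullet> u = 1" and j: "j < n"
  shows "u \<bullet> col (residual u H) j = 0"
proof -
  have h: "col H j \<in> carrier_vec m" using H by auto
  have "u \<bullet> col (residual u H) j = u \<bullet> col H j - (col_coords u H $ j) * (u \<bullet> u)"
    unfolding residual_def col_minus_rank1_mat[OF H u(1) col_coords_carrier[OF H] j]
    using h u(1) by (simp add: scalar_prod_minus_distrib[of _ m])
  then show ?thesis using u H j by (simp add: col_coords_def)
qed

lemma rank1_mat_mult_left:
  assumes A: "A \<in> carrier_mat m m" and u: "u \<in> carrier_vec m" "A *\<^sub>v u = u" and w: "w \<in> carrier_vec n"
  shows "A * rank1_mat u w = rank1_mat u w"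
proof (rule eq_matI)
  fix i j assume "i < dim_row (rank1_mat u w)" "j < dim_col (rank1_mat u w)"
  then have i: "i < m" and j: "j < n" using rank1_mat_carrier[OF u(1) w] by auto
  have "(A * rank1_mat u w) $$ (i, j) = (\<Sum>k<m. A $$ (i, k) * u $ k) * w $ j"
    using A i j u(1) w by (simp add: rank1_mat_def scalar_prod_def atLeast0LessThan sum_distrib_right mult.assoc)
  also have "(\<Sum>k<m. A $$ (i, k) * u $ k) = (A *\<^sub>v u) $ i"
    using A i u(1) by (simp add: scalar_prod_def atLeast0LessThan)
  finally show "(A * rank1_mat u w) $$ (i, j) = rank1_mat u w $$ (i, j)"
    using u i j w by (simp add: rank1_mat_index[of _ m _ n])
qed (use A rank1_mat_carrier[OF u(1) w] in auto)

lemma rank1_mat_mult_right: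
  assumes u: "u \<in> carrier_vec m" and w: "w \<in> carrier_vec n" and W: "W \<in> carrier_mat n k"
  shows "rank1_mat u w * W = rank1_mat u (transpose_mat W *\<^sub>v w)"
  using u w W by (intro eq_matI)
    (auto simp: rank1_mat_def scalar_prod_def atLeast0LessThan sum_distrib_left mult_ac)

text \<open>\<open>ReLU\<close> maps \<open>u y\<^sup>T\<close> to \<open>u ReLU(y)\<^sup>T\<close> when \<open>u \<ge> 0\<close> and is 1-Lipschitz, so it does not increase
  the distance to the space of these matrices.\<close>

lemma frobenius_sq_relu_residual_le:
  assumes H: "H \<in> carrier_mat m n" and y: "y \<in> carrier_vec n"
    and u: "u \<in> carrier_vec m" "u \<bullet> u = 1" "\<And>i. i < m \<Longrightarrow> 0 \<le> u $ i"
  shows "frobenius_sq (residual u (map_mat relu H)) \<le> frobenius_sq (H - rank1_mat u y)"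
proof -
  let ?y = "map_vec relu y"
  have y': "?y \<in> carrier_vec n" and H': "map_mat relu H \<in> carrier_mat m n" using y H by auto
  have "frobenius_sq (residual u (map_mat relu H)) \<le> frobenius_sq (map_mat relu H - rank1_mat u ?y)"
    by (rule frobenius_sq_residual_le[OF H' u(1,2) y'])
  also have "\<dots> \<le> frobenius_sq (H - rank1_mat u y)"
  proof (rule frobenius_sq_mono_abs[of _ m n])
    fix i j assume i: "i < m" and j: "j < n"
    have "u $ i * relu (y $ j) = relu (u $ i * y $ j)"
      using u(3)[OF i] by (auto simp: relu_def max_def mult_le_0_iff zero_le_mult_iff)
    then show "\<bar>(map_mat relu H - rank1_mat u ?y) $$ (i, j)\<bar> \<le> \<bar>(H - rank1_mat u y) $$ (i, j)\<bar>"
      using H u(1) y i j by (simp add: rank1_mat_def relu_def)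
  qed (use H H' rank1_mat_carrier[OF u(1) y] rank1_mat_carrier[OF u(1) y'] in auto)
  finally show ?thesis .
qed

section \<open>Norm and residual after \<open>l\<close> layers\<close>

lemma gcn_carrier:
  assumes "Ah \<in> carrier_mat N N" "X \<in> carrier_mat N (width 0)"
    and "\<And>t. t < l \<Longrightarrow> W t \<in> carrier_mat (width t) (width (Suc t))"
  shows "gcn Ah X W l \<in> carrier_mat N (width l)"
  using assms(3)
proof (induction l)
  case (Suc l)
  then have "gcn Ah X W l \<in> carrier_mat N (width l)" "W l \<in> carrier_mat (width l) (width (Suc l))" by auto
  then show ?case using assms(1) by auto
qed (use assms in auto)

text \<open>Controls the coordinates along \<open>u\<close>, where no factor \<open>r\<close> is
  gained: \<open>Ah\<close> is nonexpansive and ReLU does not increase absolute values.\<close>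

lemma gcn_frobenius_le:
  assumes Ah: "Ah \<in> carrier_mat N N" and X: "X \<in> carrier_mat N (width 0)"
    and contr: "\<And>v. v \<in> carrier_vec N \<Longrightarrow> (Ah *\<^sub>v v) \<bullet> (Ah *\<^sub>v v) \<le> v \<bullet> v"
    and W: "\<And>t. t < l \<Longrightarrow> W t \<in> carrier_mat (width t) (width (Suc t))"
    and b: "\<And>t. t < l \<Longrightarrow> spectral_norm (W t) \<le> b"
  shows "frobenius_sq (gcn Ah X W l) \<le> (b ^ l)\<^sup>2 * frobenius_sq X"
  using W b
proof (induction l)
  case (Suc l)
  let ?H = "gcn Ah X W l"
  have H: "?H \<in> carrier_mat N (width l)" using gcn_carrier[of Ah N X width l W] Ah X Suc.prems(1) by simp
  have Wl: "W l \<in> carrier_mat (width l) (width (Suc l))" and bl: "spectral_norm (W l) \<le> b"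
    using Suc.prems by auto
  have AH: "Ah * ?H \<in> carrier_mat N (width l)" using Ah H by auto
  have "frobenius_sq (gcn Ah X W (Suc l)) \<le> frobenius_sq (Ah * ?H * W l)"
    using AH Wl by (intro frobenius_sq_mono_abs[of _ N "width (Suc l)"]) (auto simp: relu_def)
  also have "\<dots> \<le> b\<^sup>2 * frobenius_sq (Ah * ?H)" by (rule frobenius_sq_mult_right_le[OF AH Wl bl])
  also have "\<dots> \<le> b\<^sup>2 * (1 * frobenius_sq ?H)"
    using contr H by (intro mult_left_mono frobenius_sq_mult_left_le[OF Ah H]) auto
  also have "\<dots> \<le> b\<^sup>2 * ((b ^ l)\<^sup>2 * frobenius_sq X)"
    using Suc by (intro mult_left_mono) auto
  finally show ?case by (simp add: power_mult_distrib mult_ac)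
qed simp

text \<open>A layer sends the part along \<open>u\<close> to a multiple of \<open>u\<close> in every
  column again, so the residuals obey their own recursion with factor \<open>r * b\<close>.\<close>

lemma gcn_residual_le:
  assumes Ah: "Ah \<in> carrier_mat N N" and X: "X \<in> carrier_mat N (width 0)"
    and u: "u \<in> carrier_vec N" "u \<bullet> u = 1" "\<And>i. i < N \<Longrightarrow> 0 \<le> u $ i" "Ah *\<^sub>v u = u"
    and contr: "\<And>v. v \<in> carrier_vec N \<Longrightarrow> u \<bullet> v = 0 \<Longrightarrow> (Ah *\<^sub>v v) \<bullet> (Ah *\<^sub>v v) \<le> r\<^sup>2 * (v \<bullet> v)"
    and W: "\<And>t. t < l \<Longrightarrow> W t \<in> carrier_mat (width t) (width (Suc t))"
    and b: "\<And>t. t < l \<Longrightarrow> spectral_norm (W t) \<le> b"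
  shows "frobenius_sq (residual u (gcn Ah X W l)) \<le> ((r * b) ^ l)\<^sup>2 * frobenius_sq X"
  using W b
proof (induction l)
  case 0
  then show ?case using frobenius_sq_residual[OF X u(1,2)] by simp
next
  case (Suc l)
  let ?H = "gcn Ah X W l"
  let ?E = "residual u ?H" and ?w = "col_coords u ?H"
  have H: "?H \<in> carrier_mat N (width l)" using gcn_carrier[of Ah N X width l W] Ah X Suc.prems(1) by simp
  have Wl: "W l \<in> carrier_mat (width l) (width (Suc l))" and bl: "spectral_norm (W l) \<le> b"
    using Suc.prems by auto
  have E: "?E \<in> carrier_mat N (width l)" using residual_carrier[OF H u(1)] .
  have w: "?w \<in> carrier_vec (width l)" using col_coords_carrier[OF H] .
  have y: "transpose_mat (W l) *\<^sub>v ?w \<in> carrier_vec (width (Suc l))"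
    using Wl w by (intro mult_mat_vec_carrier[of _ "width (Suc l)" "width l"]) auto
  have R: "rank1_mat u ?w \<in> carrier_mat N (width l)" using rank1_mat_carrier[OF u(1) w] .
  have AH: "Ah * ?H \<in> carrier_mat N (width l)" and AE: "Ah * ?E \<in> carrier_mat N (width l)"
    using Ah H E by auto
  have AHW: "Ah * ?H * W l \<in> carrier_mat N (width (Suc l))" using AH Wl by auto
  \<comment> \<open>\<open>Ah\<close> fixes \<open>u\<close>, so the rank-one part passes through
    unchanged.\<close>
  have "Ah * ?E = Ah * ?H - rank1_mat u ?w"
    unfolding residual_def mult_minus_distrib_mat[OF Ah H R] rank1_mat_mult_left[OF Ah u(1,4) w] ..
  then have split: "Ah * ?E * W l = Ah * ?H * W l - rank1_mat u (transpose_mat (W l) *\<^sub>v ?w)"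
    using minus_mult_distrib_mat[OF AH R Wl] rank1_mat_mult_right[OF u(1) w Wl] by simp
  \<comment> \<open>By \<open>split\<close> the right side is the distance of the layer before ReLU
    to one particular outer product with \<open>u\<close>.\<close>
  have "frobenius_sq (residual u (gcn Ah X W (Suc l))) \<le> frobenius_sq (Ah * ?E * W l)"
    unfolding split using frobenius_sq_relu_residual_le[OF AHW y u(1-3)] by simp
  also have "\<dots> \<le> b\<^sup>2 * frobenius_sq (Ah * ?E)" by (rule frobenius_sq_mult_right_le[OF AE Wl bl])
  also have "\<dots> \<le> b\<^sup>2 * (r\<^sup>2 * frobenius_sq ?E)"
    using contr E residual_orthogonal[OF H u(1,2)]
    by (intro mult_left_mono frobenius_sq_mult_left_le[OF Ah E]) auto
  also have "\<dots> \<le> b\<^sup>2 * (r\<^sup>2 * (((r * b) ^ l)\<^sup>2 * frobenius_sq X))"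
    using Suc by (intro mult_left_mono) auto
  finally show ?case by (simp add: power_mult_distrib mult_ac)
qed

section \<open>Wasserstein distance of push-forwards\<close>

text \<open>Gluing along the fibres of \<open>f\<close>, by two applications of the relator of \<open>pmf\<close>.\<close>

lemma couplings_lift:
  assumes r: "r \<in> couplings (map_pmf f p) (map_pmf f q)"
  shows "\<exists>s \<in> couplings p q. map_pmf (map_prod f f) s = r"
proof -
  \<comment> \<open>First gluing: \<open>t\<close> couples \<open>p\<close> with \<open>r\<close> so
    that \<open>f x\<close> is the first component of the pair drawn from \<open>r\<close>.\<close>
  have "rel_pmf (=) (map_pmf f p) (map_pmf fst r)" using r by (simp add: couplings_def pmf.rel_eq)
  then have "rel_pmf (\<lambda>x z. f x = fst z) p r" by (simp add: pmf.rel_map)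
  then obtain t where t: "\<And>x z. (x, z) \<in> set_pmf t \<Longrightarrow> f x = fst z"
    and t1: "map_pmf fst t = p" and t2: "map_pmf snd t = r" unfolding rel_pmf.simps by blast
  \<comment> \<open>Second gluing: \<open>s\<close> attaches \<open>y\<close> from \<open>q\<close>
    so that \<open>f y\<close> is the second component of that pair.\<close>
  have "map_pmf (\<lambda>z. snd (snd z)) t = map_pmf f q"
    using r t2 by (simp add: couplings_def flip: pmf.map_comp[unfolded o_def, of snd snd])
  then have "rel_pmf (=) (map_pmf (\<lambda>z. snd (snd z)) t) (map_pmf f q)" by (simp add: pmf.rel_eq)
  then have "rel_pmf (\<lambda>z y. snd (snd z) = f y) t q" by (simp add: pmf.rel_map)
  then obtain s where s: "\<And>z y. (z, y) \<in> set_pmf s \<Longrightarrow> snd (snd z) = f y"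
    and s1: "map_pmf fst s = t" and s2: "map_pmf snd s = q" unfolding rel_pmf.simps by blast
  \<comment> \<open>Forgetting the pair in the middle leaves a coupling of \<open>p\<close> and
    \<open>q\<close>; on the support of \<open>s\<close> its image under \<open>f\<close> is the
    forgotten pair.\<close>
  let ?s = "map_pmf (\<lambda>(z, y). (fst z, y)) s"
  have "map_pmf fst ?s = map_pmf fst (map_pmf fst s)" "map_pmf snd ?s = map_pmf snd s"
    by (auto simp: pmf.map_comp o_def case_prod_beta)
  then have "?s \<in> couplings p q" using s1 s2 t1 by (simp add: couplings_def)
  moreover have "map_pmf (map_prod f f) ?s = r"
  proof -
    have "map_pmf (map_prod f f) ?s = map_pmf (\<lambda>x. snd (fst x)) s"
      unfolding pmf.map_comp
    proof (rule map_pmf_cong[OF refl])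
      fix x assume x: "x \<in> set_pmf s"
      obtain a b c y where xy: "x = ((a, b, c), y)" by (metis prod.exhaust)
      have "(a, b, c) \<in> set_pmf t" using x unfolding s1[symmetric] xy by force
      then show "(map_prod f f \<circ> (\<lambda>(z, y). (fst z, y))) x = snd (fst x)"
        using t[of a "(b, c)"] s[of "(a, b, c)" y] x unfolding xy by simp
    qed
    also have "\<dots> = map_pmf snd (map_pmf fst s)" by (simp add: pmf.map_comp o_def)
    finally show ?thesis using s1 t2 by simp
  qed
  ultimately show ?thesis by blast
qed

text \<open>Any coupling of the images under \<open>f\<close> lifts to one of \<open>p\<close> and
  \<open>q\<close>; pushing the lift forward by \<open>g\<close> gives an admissible plan whose cost
  is bounded pointwise by \<open>le\<close>. The infimum over the original couplings is taken
  last.\<close>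

lemma wasserstein_map_le:
  assumes fin: "finite (set_pmf p)" "finite (set_pmf q)"
    and le: "\<And>x y. x \<in> set_pmf p \<Longrightarrow> y \<in> set_pmf q \<Longrightarrow> c (g x) (g y) \<le> K * c' (f x) (f y) + e"
    and c: "\<And>x y. 0 \<le> c x y" and K: "0 \<le> K"
  shows "wasserstein c (map_pmf g p) (map_pmf g q) \<le> K * wasserstein c' (map_pmf f p) (map_pmf f q) + e"
proof -
  let ?W = "wasserstein c (map_pmf g p) (map_pmf g q)"
  let ?E = "\<lambda>r. measure_pmf.expectation r (\<lambda>(x, y). c' x y)"
  have main: "?W \<le> K * ?E r + e" if r: "r \<in> couplings (map_pmf f p) (map_pmf f q)" for r
  proof -
    obtain s where s: "s \<in> couplings p q" and sr: "map_pmf (map_prod f f) s = r"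
      using couplings_lift[OF r] by blast
    have sub: "set_pmf s \<subseteq> set_pmf p \<times> set_pmf q"
      using s unfolding couplings_def by force
    then have fs: "finite (set_pmf s)" using fin finite_subset by blast
    have "map_pmf fst (map_pmf (map_prod g g) s) = map_pmf g (map_pmf fst s)"
      "map_pmf snd (map_pmf (map_prod g g) s) = map_pmf g (map_pmf snd s)"
      by (simp_all add: pmf.map_comp o_def)
    then have "map_pmf (map_prod g g) s \<in> couplings (map_pmf g p) (map_pmf g q)"
      using s by (simp add: couplings_def)
    \<comment> \<open>Nonnegative cost bounds the set of expectations below, so its infimum is at
      most each member.\<close>
    then have "?W \<le> measure_pmf.expectation (map_pmf (map_prod g g) s) (\<lambda>(x, y). c x y)"
      unfolding wasserstein_def
      by (intro cINF_lower bdd_belowI[of _ 0]) (auto intro!: Bochner_Integration.integral_nonneg simp: c case_prod_beta)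
    also have "\<dots> = measure_pmf.expectation s (\<lambda>z. c (g (fst z)) (g (snd z)))"
      by (simp add: case_prod_beta)
    also have "\<dots> \<le> measure_pmf.expectation s (\<lambda>z. K * c' (f (fst z)) (f (snd z)) + e)"
      using le sub fs
      by (intro integral_mono_AE integrable_measure_pmf_finite) (auto simp: AE_measure_pmf_iff)
    also have "\<dots> = K * measure_pmf.expectation s (\<lambda>z. c' (f (fst z)) (f (snd z))) + e"
      using fs by (simp add: integrable_measure_pmf_finite)
    also have "measure_pmf.expectation s (\<lambda>z. c' (f (fst z)) (f (snd z))) = ?E r"
      unfolding sr[symmetric] by (simp add: case_prod_beta)
    finally show ?thesis .
  qed
  \<comment> \<open>The independent coupling shows that the infimum is over a nonempty set.\<close>
  have "pair_pmf (map_pmf f p) (map_pmf f q) \<in> couplings (map_pmf f p) (map_pmf f q)"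
    by (simp add: couplings_def map_fst_pair_pmf map_snd_pair_pmf)
  then have ne: "couplings (map_pmf f p) (map_pmf f q) \<noteq> {}" by blast
  show ?thesis
  \<comment> \<open>For \<open>K > 0\<close> the bound is divided by \<open>K\<close> to pass to the
    infimum; for \<open>K = 0\<close> a single coupling suffices.\<close>
  proof (cases "K = 0")
    case True
    then show ?thesis using main ne by fastforce
  next
    case False
    then have "(?W - e) / K \<le> wasserstein c' (map_pmf f p) (map_pmf f q)"
      unfolding wasserstein_def[of c'] using main K
      by (intro cINF_greatest ne) (simp add: divide_le_eq diff_le_eq mult.commute)
    then show ?thesis using False K by (simp add: divide_le_eq diff_le_eq mult.commute)
  qed
qed

section \<open>From node distances to the Wasserstein bound\<close>

text \<open>Row \<open>i\<close> of the layer is \<open>u $ i\<close> times \<open>w\<close> plus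
  row \<open>i\<close> of \<open>E\<close>. The difference of two rows gives one term Lipschitz in
  \<open>degree_stat\<close> and two residual rows, whence the factor 2.\<close>

lemma embedding_dist_le:
  assumes A: "adjacency_matrix N A" and X: "X \<in> carrier_mat N (width 0)"
    and W: "\<And>t. t < l \<Longrightarrow> W t \<in> carrier_mat (width t) (width (Suc t))"
    and b: "\<And>t. t < l \<Longrightarrow> spectral_norm (W t) \<le> b"
    and i: "i < N" and j: "j < N"
  shows "euclid_dist (embedding A X W l i) (embedding A X W l j)
    \<le> sqrt (frobenius_sq X) * b ^ l * dist (degree_stat A i) (degree_stat A j)
      + 2 * sqrt (frobenius_sq X) * rho_perp (normalized_adjacency A) ^ l * b ^ l"
proof -
  let ?Ah = "normalized_adjacency A" and ?d = "vec N (degree_stat A)" and ?s = "sqrt (frobenius_sq X)"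
  let ?r = "rho_perp ?Ah"
  note Ah = normalized_adjacency_carrier[OF A] and sym = normalized_adjacency_sym[OF A]
  define nd where "nd = euclid_norm ?d"
  \<comment> \<open>One node already makes the norm at least 1, so normalizing does not enlarge
    differences of \<open>degree_stat\<close>.\<close>
  have "1\<^sup>2 \<le> (degree_stat A i)\<^sup>2" using degree_stat_ge_1[OF A i] by (intro power_mono) auto
  also have "\<dots> \<le> (\<Sum>k<N. (degree_stat A k)\<^sup>2)" using i by (intro member_le_sum) auto
  also have "\<dots> = nd\<^sup>2" unfolding nd_def euclid_norm_sum by simp
  finally have nd: "1 \<le> nd" unfolding nd_def using power2_le_imp_le euclid_norm_nonneg by blast
  define u where "u = (1 / nd) \<cdot>\<^sub>v ?d"
  have u: "u \<in> carrier_vec N" unfolding u_def by simp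
  have uk: "u $ k = degree_stat A k / nd" if "k < N" for k using that by (simp add: u_def)
  have uu: "u \<bullet> u = 1"
    unfolding euclid_norm_square[symmetric] u_def euclid_norm_smult nd_def[symmetric] using nd by simp
  have u0: "0 \<le> u $ k" if "k < N" for k using uk[OF that] degree_stat_ge_1[OF A that] nd by simp
  have Au: "?Ah *\<^sub>v u = u"
    unfolding u_def using mult_mat_vec[OF Ah, of ?d] normalized_adjacency_degree_stat[OF A] by simp
  have "u \<noteq> 0\<^sub>v N" using uu by auto
  then have contr: "(?Ah *\<^sub>v v) \<bullet> (?Ah *\<^sub>v v) \<le> ?r\<^sup>2 * (v \<bullet> v)"
    if "v \<in> carrier_vec N" "u \<bullet> v = 0" for v
    using rho_perp_contraction[OF Ah sym u _ _ that] Au normalized_adjacency_eigval_1[OF A] i by simp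
  let ?H = "gcn ?Ah X W l"
  have H: "?H \<in> carrier_mat N (width l)" using gcn_carrier[where width = width, OF Ah X] W by blast
  define w where "w = col_coords u ?H"
  define E where "E = residual u ?H"
  have w: "w \<in> carrier_vec (width l)" unfolding w_def by (rule col_coords_carrier[OF H])
  have E: "E \<in> carrier_mat N (width l)" unfolding E_def by (rule residual_carrier[OF H u])
  \<comment> \<open>For \<open>l = 0\<close> no weight constrains the sign of \<open>b\<close>, but
    then the power is 1; otherwise \<open>b\<close> bounds a norm.\<close>
  have bl: "0 \<le> b ^ l"
  proof (cases l)
    case (Suc m)
    then have "0 \<le> b" using b[of 0] spectral_norm_nonneg[of "W 0"] by simp
    then show ?thesis by simp
  qed simp
  have "(euclid_norm w)\<^sup>2 \<le> frobenius_sq ?H"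
    using frobenius_sq_residual[OF H u uu] frobenius_sq_nonneg[of "residual u ?H"] unfolding w_def by simp
  also have "\<dots> \<le> (b ^ l)\<^sup>2 * frobenius_sq X"
    by (rule gcn_frobenius_le[where width = width, OF Ah X normalized_adjacency_norm_le[OF A] W b])
  also have "\<dots> = (?s * b ^ l)\<^sup>2" using frobenius_sq_nonneg by (simp add: power_mult_distrib mult.commute)
  finally have "(euclid_norm w)\<^sup>2 \<le> (?s * b ^ l)\<^sup>2" .
  moreover have "0 \<le> ?s * b ^ l" using bl frobenius_sq_nonneg by simp
  ultimately have wle: "euclid_norm w \<le> ?s * b ^ l" by (rule power2_le_imp_le)
  have Ele: "euclid_norm (row E k) \<le> ?s * ?r ^ l * b ^ l" if "k < N" for k
  proof -
    have "euclid_norm (row E k) \<le> sqrt (frobenius_sq E)"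
      using that E by (intro euclid_norm_row_le_frobenius) auto
    also have "\<dots> \<le> sqrt (((?r * b) ^ l)\<^sup>2 * frobenius_sq X)"
      unfolding E_def
      by (intro real_sqrt_le_mono gcn_residual_le[where width = width, OF Ah X u uu u0 Au contr W b])
    also have "\<dots> = ?s * ?r ^ l * b ^ l"
      using bl rho_perp_nonneg[of ?Ah] by (simp add: real_sqrt_mult power_mult_distrib abs_mult mult_ac)
    finally show ?thesis .
  qed
  have rowE: "row E k \<in> carrier_vec (width l)" for k using E by (metis carrier_matD(2) row_carrier)
  have rowH: "row ?H k $ m = u $ k * w $ m + row E k $ m" if "k < N" "m < width l" for k m
    unfolding E_def residual_def w_def[symmetric] using that H u w
    by (simp add: rank1_mat_def)
  \<comment> \<open>The difference is written with a factor -1 so that the triangle inequality for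
    sums applies.\<close>
  have "row ?H i - row ?H j = (u $ i - u $ j) \<cdot>\<^sub>v w + (row E i + (-1) \<cdot>\<^sub>v row E j)"
  proof (rule eq_vecI)
    have dims: "dim_col ?H = width l" "dim_col E = width l" "dim_vec w = width l" using H E w by auto
    show "dim_vec (row ?H i - row ?H j) = dim_vec ((u $ i - u $ j) \<cdot>\<^sub>v w + (row E i + (-1) \<cdot>\<^sub>v row E j))"
      by (simp add: dims)
    fix m assume "m < dim_vec ((u $ i - u $ j) \<cdot>\<^sub>v w + (row E i + (-1) \<cdot>\<^sub>v row E j))"
    then have m: "m < width l" by (simp add: dims)
    show "(row ?H i - row ?H j) $ m = ((u $ i - u $ j) \<cdot>\<^sub>v w + (row E i + (-1) \<cdot>\<^sub>v row E j)) $ m"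
      using m by (simp add: dims rowH[OF i m] rowH[OF j m] left_diff_distrib del: index_row(1))
  qed
  then have "euclid_dist (row ?H i) (row ?H j) \<le> \<bar>u $ i - u $ j\<bar> * euclid_norm w + (euclid_norm (row E i) + euclid_norm (row E j))"
    unfolding euclid_dist_def
    using euclid_norm_triangle[of "(u $ i - u $ j) \<cdot>\<^sub>v w" "width l" "row E i + (-1) \<cdot>\<^sub>v row E j"]
      euclid_norm_triangle[of "row E i" "width l" "(-1) \<cdot>\<^sub>v row E j"] w rowE[of i] rowE[of j]
    by (simp add: euclid_norm_smult)
  also have "\<dots> \<le> dist (degree_stat A i) (degree_stat A j) * (?s * b ^ l) + (?s * ?r ^ l * b ^ l + ?s * ?r ^ l * b ^ l)"
  proof (intro add_mono mult_mono Ele i j wle)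
    have "\<bar>u $ i - u $ j\<bar> = \<bar>degree_stat A i - degree_stat A j\<bar> / nd"
      using nd by (simp add: uk i j diff_divide_distrib[symmetric])
    also have "\<dots> \<le> \<bar>degree_stat A i - degree_stat A j\<bar> / 1"
      using nd by (intro divide_left_mono) auto
    finally show "\<bar>u $ i - u $ j\<bar> \<le> dist (degree_stat A i) (degree_stat A j)" by (simp add: dist_real_def)
  qed (use euclid_norm_nonneg in auto)
  finally show ?thesis by (simp add: embedding_def algebra_simps)
qed

theorem proposition6p2:
  shows "\<exists>C\<^sub>1 C\<^sub>2 :: real mat \<Rightarrow> real mat \<Rightarrow> real.
    \<forall>(N::nat) (F::nat) (A::real mat) (X::real mat).
      adjacency_matrix N A \<longrightarrow> X \<in> carrier_mat N F \<longrightarrow>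
      (\<forall>(L::nat) (width::nat \<Rightarrow> nat) (W::nat \<Rightarrow> real mat) (\<beta>::real).
        width 0 = F \<longrightarrow>
        (\<forall>t<L. W t \<in> carrier_mat (width t) (width (Suc t))) \<longrightarrow>
        (\<forall>t<L. spectral_norm (W t) \<le> \<beta>) \<longrightarrow>
        (\<forall>(S::nat set) (T::nat set) (l::nat).
          S \<noteq> {} \<longrightarrow> S \<subseteq> {0..<N} \<longrightarrow> T \<noteq> {} \<longrightarrow> T \<subseteq> {0..<N} \<longrightarrow> l \<le> L \<longrightarrow>
          wasserstein euclid_dist
            (map_pmf (embedding A X W l) (pmf_of_set S))
            (map_pmf (embedding A X W l) (pmf_of_set T))
          \<le> (C\<^sub>1 X (normalized_adjacency A) *
                wasserstein dist
                  (map_pmf (degree_stat A) (pmf_of_set S))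
                  (map_pmf (degree_stat A) (pmf_of_set T))
              + C\<^sub>2 X (normalized_adjacency A) * rho_perp (normalized_adjacency A) ^ l) * \<beta> ^ l))"
proof (intro exI allI impI)
  fix N F L l :: nat and A X :: "real mat" and width W and \<beta> :: real and S T :: "nat set"
  assume A: "adjacency_matrix N A" and X: "X \<in> carrier_mat N F" and wd: "width 0 = F"
    and W: "\<forall>t<L. W t \<in> carrier_mat (width t) (width (Suc t))"
    and b: "\<forall>t<L. spectral_norm (W t) \<le> \<beta>"
    and S: "S \<noteq> {}" "S \<subseteq> {0..<N}" and T: "T \<noteq> {}" "T \<subseteq> {0..<N}" and l: "l \<le> L"
  have fin: "finite S" "finite T" using S T finite_subset by blast+
  have bl: "0 \<le> \<beta> ^ l"
  proof (cases l)
    case (Suc m)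
    then have "0 \<le> \<beta>" using b l spectral_norm_nonneg[of "W 0"] by fastforce
    then show ?thesis by simp
  qed simp
  let ?s = "sqrt (frobenius_sq X)"
  have "wasserstein euclid_dist (map_pmf (embedding A X W l) (pmf_of_set S)) (map_pmf (embedding A X W l) (pmf_of_set T))
    \<le> ?s * \<beta> ^ l * wasserstein dist (map_pmf (degree_stat A) (pmf_of_set S)) (map_pmf (degree_stat A) (pmf_of_set T))
      + 2 * ?s * rho_perp (normalized_adjacency A) ^ l * \<beta> ^ l"
  proof (rule wasserstein_map_le)
    fix i j assume "i \<in> set_pmf (pmf_of_set S)" "j \<in> set_pmf (pmf_of_set T)"
    then have "i < N" "j < N" using S T fin by auto
    then show "euclid_dist (embedding A X W l i) (embedding A X W l j)
      \<le> ?s * \<beta> ^ l * dist (degree_stat A i) (degree_stat A j)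
        + 2 * ?s * rho_perp (normalized_adjacency A) ^ l * \<beta> ^ l"
      using W b l X wd by (intro embedding_dist_le[where width = width, OF A]) auto
  qed (use S T fin bl frobenius_sq_nonneg in \<open>auto simp: euclid_dist_def euclid_norm_nonneg\<close>)
  \<comment> \<open>The constants left open by \<open>exI\<close> are fixed here: the Frobenius norm
    of \<open>X\<close> and twice that norm.\<close>
  then show "wasserstein euclid_dist (map_pmf (embedding A X W l) (pmf_of_set S)) (map_pmf (embedding A X W l) (pmf_of_set T))
    \<le> ((\<lambda>X _. sqrt (frobenius_sq X)) X (normalized_adjacency A) *
        wasserstein dist (map_pmf (degree_stat A) (pmf_of_set S)) (map_pmf (degree_stat A) (pmf_of_set T))
      + (\<lambda>X _. 2 * sqrt (frobenius_sq X)) X (normalized_adjacency A) * rho_perp (normalized_adjacency A) ^ l) * \<beta> ^ l"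
    by (simp add: algebra_simps)
qed

end
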